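(* Every initially subamenable group and every residually finite group is $L^1$-surjunctive and dual $L^1$-surjunctive.
   Context: A group $G$ is initially subamenable if for every finite $E\subset G$ there exist an amenable group $H$ and an injective map $\varphi\colon E\to H$ with $\varphi(gh)=\varphi(g)\varphi(h)$ for all $g,h\in E$ with $gh\in E$. $G$ is residually finite if for every finite $F\subset G$ there is a surjective homomorphism onto a finite group injective on $F$. Configurations: $A^G$ is the set of maps $G\to A$ with the prodiscrete topology; $(gx)(h)=x(g^{-1}h)$. Two configurations are asymptotic if they agree outside a finite set. For $M\subset G$, $S$ a set of maps $A^M\to A$, $s\in S^G$, $\sigma_s(x)(g)=s(g)((g^{-1}x)\vert_M)$. $\Sigma(s)$ is the closure of $\{gs:g\in G\}$ in $S^G$. $\sigma_s$ is stably injective if $\sigma_p$ is injective for all $p\in\Sigma(s)$; pre-injective if $\sigma_s(x)=\sigma_s(y)$ with $x,y$ asymptotic implies $x=y$; post-surjective if whenever $y$ is asymptotic to $\sigma_s(x)$ there is $z$ asymptotic to $x$ with $\sigma_s(z)=y$; stably post-surjective if $\sigma_p$ is post-surjective for all $p\in\Sigma(s)$. For a vector space $V$, $\mathrm{LNUCA}_c(G,V)$ is the set of $\sigma_s\colon V^G\to V^G$ with $M$ finite, $s\in\mathcal{L}(V^M,V)^G$ constant outside a finite subset of $G$. $G$ is $L^1$-surjunctive if for every finite-dimensional vector space $V$ over any field, every stably injective $\tau\in\mathrm{LNUCA}_c(G,V)$ is surjective; dual $L^1$-surjunctive if for every such $V$, every stably post-surjective $\tau\in\mathrm{LNUCA}_c(G,V)$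 is pre-injective. *)

theory Defs
  imports "HOL-Algebra.Coset" "HOL-Analysis.Function_Topology"
begin

definition amenable :: "('h, 'c) monoid_scheme \<Rightarrow> bool" where
  "amenable H \<longleftrightarrow> (\<exists>\<mu> :: 'h set \<Rightarrow> real.
      \<mu> (carrier H) = 1 \<and>
      (\<forall>A. A \<subseteq> carrier H \<longrightarrow> \<mu> A \<ge> 0) \<and>
      (\<forall>A B. A \<subseteq> carrier H \<longrightarrow> B \<subseteq> carrier H \<longrightarrow> A \<inter> B = {} \<longrightarrow> \<mu> (A \<union> B) = \<mu> A + \<mu> B) \<and>
      (\<forall>g A. g \<in> carrier H \<longrightarrow> A \<subseteq> carrier H \<longrightarrow> \<mu> (g <#\<^bsub>H\<^esub> A) = \<mu> A))"

text \<open>The target groups range over an arbitrary type 'h; since the main theorem is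
  universally quantified over this type, this amounts to "there exists a group".\<close>

definition initially_subamenable :: "'h itself \<Rightarrow> ('g, 'c) monoid_scheme \<Rightarrow> bool" where
  "initially_subamenable (_ :: 'h itself) G \<longleftrightarrow>
     (\<forall>E. finite E \<longrightarrow> E \<subseteq> carrier G \<longrightarrow>
        (\<exists>(H :: 'h monoid) \<phi>. group H \<and> amenable H \<and> \<phi> \<in> E \<rightarrow> carrier H \<and> inj_on \<phi> E \<and>
           (\<forall>g\<in>E. \<forall>h\<in>E. g \<otimes>\<^bsub>G\<^esub> h \<in> E \<longrightarrow> \<phi> (g \<otimes>\<^bsub>G\<^esub> h) = \<phi> g \<otimes>\<^bsub>H\<^esub> \<phi> h)))"

definition residually_finite :: "'h itself \<Rightarrow> ('g, 'c) monoid_scheme \<Rightarrow> bool" where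
  "residually_finite (_ :: 'h itself) G \<longleftrightarrow>
     (\<forall>F. finite F \<longrightarrow> F \<subseteq> carrier G \<longrightarrow>
        (\<exists>(H :: 'h monoid) \<phi>. group H \<and> finite (carrier H) \<and> \<phi> \<in> hom G H \<and>
           \<phi> ` carrier G = carrier H \<and> inj_on \<phi> F))"

text \<open>Configurations in A^G are the extensional functions in PiE (carrier G) A.
  Elements of A^M are extensional functions in M PiE (carrier G) A.\<close>

definition translate :: "('g, 'c) monoid_scheme \<Rightarrow> 'g \<Rightarrow> ('g \<Rightarrow> 'a) \<Rightarrow> 'g \<Rightarrow> 'a" where
  "translate G g x = (\<lambda>h\<in>carrier G. x (inv\<^bsub>G\<^esub> g \<otimes>\<^bsub>G\<^esub> h))"

definition asymptotic :: "('g, 'c) monoid_scheme \<Rightarrow> ('g \<Rightarrow> 'a) \<Rightarrow> ('g \<Rightarrow> 'a) \<Rightarrow> bool" where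
  "asymptotic G x y \<longleftrightarrow> finite {g \<in> carrier G. x g \<noteq> y g}"

text \<open>sigma_s(x)(g) = s(g)((g^-1 x)|M), and (g^-1 x)(h) = x(g h).\<close>
definition nuca :: "('g, 'c) monoid_scheme \<Rightarrow> 'g set \<Rightarrow> ('g \<Rightarrow> ('g \<Rightarrow> 'a) \<Rightarrow> 'a) \<Rightarrow> ('g \<Rightarrow> 'a) \<Rightarrow> 'g \<Rightarrow> 'a" where
  "nuca G M s x = (\<lambda>g\<in>carrier G. s g (\<lambda>h\<in>M. x (g \<otimes>\<^bsub>G\<^esub> h)))"

definition orbit_closure :: "('g, 'c) monoid_scheme \<Rightarrow> 'b set \<Rightarrow> ('g \<Rightarrow> 'b) \<Rightarrow> ('g \<Rightarrow> 'b) set" where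
  "orbit_closure G S s =
     (product_topology (\<lambda>_. discrete_topology S) (carrier G)) closure_of
       ((\<lambda>g. translate G g s) ` carrier G)"

definition stably_injective ::
  "('g, 'c) monoid_scheme \<Rightarrow> 'a set \<Rightarrow> 'g set \<Rightarrow> (('g \<Rightarrow> 'a) \<Rightarrow> 'a) set \<Rightarrow> ('g \<Rightarrow> ('g \<Rightarrow> 'a) \<Rightarrow> 'a) \<Rightarrow> bool" where
  "stably_injective G A M S s \<longleftrightarrow>
     (\<forall>p \<in> orbit_closure G S s. inj_on (nuca G M p) (carrier G \<rightarrow>\<^sub>E A))"

definition pre_injective ::
  "('g, 'c) monoid_scheme \<Rightarrow> 'a set \<Rightarrow> 'g set \<Rightarrow> ('g \<Rightarrow> ('g \<Rightarrow> 'a) \<Rightarrow> 'a) \<Rightarrow> bool" where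
  "pre_injective G A M s \<longleftrightarrow>
     (\<forall>x \<in> carrier G \<rightarrow>\<^sub>E A. \<forall>y \<in> carrier G \<rightarrow>\<^sub>E A.
        asymptotic G x y \<longrightarrow> nuca G M s x = nuca G M s y \<longrightarrow> x = y)"

definition post_surjective ::
  "('g, 'c) monoid_scheme \<Rightarrow> 'a set \<Rightarrow> 'g set \<Rightarrow> ('g \<Rightarrow> ('g \<Rightarrow> 'a) \<Rightarrow> 'a) \<Rightarrow> bool" where
  "post_surjective G A M s \<longleftrightarrow>
     (\<forall>x \<in> carrier G \<rightarrow>\<^sub>E A. \<forall>y \<in> carrier G \<rightarrow>\<^sub>E A.
        asymptotic G y (nuca G M s x) \<longrightarrow>
        (\<exists>z \<in> carrier G \<rightarrow>\<^sub>E A. asymptotic G z x \<and> nuca G M s z = y))"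

definition stably_post_surjective ::
  "('g, 'c) monoid_scheme \<Rightarrow> 'a set \<Rightarrow> 'g set \<Rightarrow> (('g \<Rightarrow> 'a) \<Rightarrow> 'a) set \<Rightarrow> ('g \<Rightarrow> ('g \<Rightarrow> 'a) \<Rightarrow> 'a) \<Rightarrow> bool" where
  "stably_post_surjective G A M S s \<longleftrightarrow>
     (\<forall>p \<in> orbit_closure G S s. post_surjective G A M p)"

definition lin_maps :: "('k \<Rightarrow> 'v::ab_group_add \<Rightarrow> 'v) \<Rightarrow> 'g set \<Rightarrow> (('g \<Rightarrow> 'v) \<Rightarrow> 'v) set" where
  "lin_maps smult_v M =
     {f \<in> (M \<rightarrow>\<^sub>E (UNIV :: 'v set)) \<rightarrow>\<^sub>E UNIV.
        (\<forall>x \<in> M \<rightarrow>\<^sub>E UNIV. \<forall>y \<in> M \<rightarrow>\<^sub>E UNIV. f (\<lambda>h\<in>M. x h + y h) = f x + f y) \<and>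
        (\<forall>c. \<forall>x \<in> M \<rightarrow>\<^sub>E UNIV. f (\<lambda>h\<in>M. smult_v c (x h)) = smult_v c (f x))}"

definition LNUCA_c_param ::
  "('g, 'c) monoid_scheme \<Rightarrow> ('k \<Rightarrow> 'v::ab_group_add \<Rightarrow> 'v) \<Rightarrow> 'g set \<Rightarrow> ('g \<Rightarrow> ('g \<Rightarrow> 'v) \<Rightarrow> 'v) \<Rightarrow> bool" where
  "LNUCA_c_param G smult_v M s \<longleftrightarrow>
     finite M \<and> M \<subseteq> carrier G \<and> s \<in> carrier G \<rightarrow>\<^sub>E lin_maps smult_v M \<and>
     (\<exists>F c. finite F \<and> F \<subseteq> carrier G \<and> (\<forall>g \<in> carrier G - F. s g = c))"

definition L1_surjunctive :: "'k::field itself \<Rightarrow> 'v::ab_group_add itself \<Rightarrow> ('g, 'c) monoid_scheme \<Rightarrow> bool" where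
  "L1_surjunctive (_ :: 'k itself) (_ :: 'v itself) G \<longleftrightarrow>
     (\<forall>(smult_v :: 'k \<Rightarrow> 'v \<Rightarrow> 'v) Basis. finite_dimensional_vector_space smult_v Basis \<longrightarrow>
        (\<forall>M s. LNUCA_c_param G smult_v M s \<longrightarrow>
           stably_injective G UNIV M (lin_maps smult_v M) s \<longrightarrow>
           nuca G M s ` (carrier G \<rightarrow>\<^sub>E UNIV) = carrier G \<rightarrow>\<^sub>E UNIV))"

definition dual_L1_surjunctive :: "'k::field itself \<Rightarrow> 'v::ab_group_add itself \<Rightarrow> ('g, 'c) monoid_scheme \<Rightarrow> bool" where
  "dual_L1_surjunctive (_ :: 'k itself) (_ :: 'v itself) G \<longleftrightarrow>
     (\<forall>(smult_v :: 'k \<Rightarrow> 'v \<Rightarrow> 'v) Basis. finite_dimensional_vector_space smult_v Basis \<longrightarrow>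
        (\<forall>M s. LNUCA_c_param G smult_v M s \<longrightarrow>
           stably_post_surjective G UNIV M (lin_maps smult_v M) s \<longrightarrow>
           pre_injective G UNIV M s))"

end

theory Submission
  imports Defs "HOL-Library.Function_Algebras"
begin


text \<open>
  In coordinates a linear NUCA is a row-finite matrix indexed by \<open>carrier G \<times> Basis\<close>. Transposition
  exchanges injectivity on all configurations with surjectivity on finitely supported ones, so
  both assertions reduce to one: a matrix which is surjective on finitely supported vectors is
  injective there. For infinite \<open>G\<close> the orbit closure contains the constant configuration \<open>c\<close>, and
  \<open>s\<close> differs from it in finitely many rows only; a dimension count then reduces the claim
  to the translation invariant matrix of \<open>c\<close>. (For finite \<open>G\<close> the identity matrix replaces it.)

  For the invariant matrix, a right inverse and a hypothetical kernel vector are finite data and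
  are transported to an amenable group \<open>H\<close>. There they yield linearly independent vectors of
  uniformly bounded support indexed by \<open>H \<times> Basis\<close> and an additional set \<open>X\<close> of positive mean;
  Hall's theorem extracts an injection into \<open>H \<times> Basis\<close> with bounded displacement, which an
  invariant mean forbids.
\<close>

section \<open>Linear systems and the marriage theorem\<close>

text \<open>Configurations are dual to finitely supported vectors, since a linear functional on the
  latter is an arbitrary family of values; hence transposition exchanges the two spaces over any
  field, without compactness. Amenability is given by a finitely additive measure on subsets, not by
  Folner sets, so dimensions cannot be counted directly: linear independence must become an
  injection of index sets before the mean can act on it, and Hall's theorem makes this conversion. A
  map that is multiplicative only on a finite set cannot carry a whole infinite matrix, let alone
  its perturbation, to \<open>H\<close>. It carries the coefficients, preimages of the unit vectors
  at the identity and one kernel vector; translation invariance recreates the rest in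
  \<open>H\<close>, which is why the perturbation has to be removed beforehand. Stability makes the
  hypothesis available for the constant configuration in addition to \<open>s\<close>.\<close>

lemma homogeneous_system_nontrivial:
  fixes w :: "'p \<Rightarrow> 'n \<Rightarrow> 'k::field"
  assumes "finite N" "finite P" "card N < card P"
  shows "\<exists>c. (\<exists>p\<in>P. c p \<noteq> 0) \<and> (\<forall>y\<in>N. (\<Sum>p\<in>P. c p * w p y) = 0)"
  using assms
proof (induction N arbitrary: P w rule: finite_induct)
  case empty
  then obtain p where "p \<in> P" by fastforce
  then show ?case by (intro exI[of _ "\<lambda>_. 1"]) auto
next
  case (insert y N)
  show ?case
  proof (cases "\<forall>p\<in>P. w p y = 0")
    case True
    have "card N < card P" using insert by simp
    then obtain c where "\<exists>p\<in>P. c p \<noteq> 0" "\<forall>y\<in>N. (\<Sum>p\<in>P. c p * w p y) = 0"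
      using insert.IH[OF insert.prems(1)] by blast
    then show ?thesis using True by (intro exI[of _ c]) simp
  next
    case False
    then obtain p0 where p0: "p0 \<in> P" "w p0 y \<noteq> 0" by blast
    define P' where "P' = P - {p0}"
    have P': "finite P'" "P = insert p0 P'" "p0 \<notin> P'" "card N < card P'"
      using p0 insert by (auto simp: P'_def)
    obtain c where c: "\<exists>p\<in>P'. c p \<noteq> 0"
      "\<forall>x\<in>N. (\<Sum>p\<in>P'. c p * (w p x - w p y / w p0 y * w p0 x)) = 0"
      using insert.IH[OF P'(1,4), of "\<lambda>p x. w p x - w p y / w p0 y * w p0 x"] by blast
    \<comment> \<open>Equation \<open>y\<close> forces this value on the eliminated unknown
      \<open>p0\<close>; with it the remaining equations become the reduced ones already solved by
      \<open>c\<close>.\<close>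
    define c0 where "c0 = - (\<Sum>p\<in>P'. c p * (w p y / w p0 y))"
    define c' where "c' = c(p0 := c0)"
    have eq: "(\<Sum>p\<in>P. c' p * w p x) = (\<Sum>p\<in>P'. c p * (w p x - w p y / w p0 y * w p0 x))" for x
    proof -
      have "(\<Sum>p\<in>P. c' p * w p x) = c0 * w p0 x + (\<Sum>p\<in>P'. c' p * w p x)"
        using P' by (simp add: c'_def)
      also have "(\<Sum>p\<in>P'. c' p * w p x) = (\<Sum>p\<in>P'. c p * w p x)"
        using P' by (intro sum.cong) (auto simp: c'_def)
      also have "c0 * w p0 x = - (\<Sum>p\<in>P'. c p * (w p y / w p0 y * w p0 x))"
        by (simp add: c0_def sum_distrib_right mult.assoc)
      finally show ?thesis by (simp add: right_diff_distrib sum_subtractf)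
    qed
    have "(\<Sum>p\<in>P. c' p * w p x) = 0" if "x \<in> insert y N" for x
    proof (cases "x = y")
      case True
      then show ?thesis using p0 by (simp add: eq)
    next
      case False
      then show ?thesis using that c(2) by (simp add: eq)
    qed
    moreover have "\<exists>p\<in>P. c' p \<noteq> 0" using c(1) P' by (auto simp: c'_def)
    ultimately show ?thesis by blast
  qed
qed

section \<open>Hall's marriage theorem for infinite families of finite sets\<close>

definition hall_family :: "'a set \<Rightarrow> ('a \<Rightarrow> 'b set) \<Rightarrow> bool" where
  "hall_family A N \<longleftrightarrow> (\<forall>P. finite P \<longrightarrow> P \<subseteq> A \<longrightarrow> card P \<le> card (\<Union>p\<in>P. N p))"

lemma hall_familyD:
  "hall_family A N \<Longrightarrow> finite P \<Longrightarrow> P \<subseteq> A \<Longrightarrow> card P \<le> card (\<Union>p\<in>P. N p)"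
  by (simp add: hall_family_def)

text \<open>Rado's argument: a Hall family that is minimal under shrinking consists of singletons, which
  settles finite and infinite families at once.\<close>
lemma hall_family_remove:
  assumes hall: "hall_family A N" and fin: "\<And>a. a \<in> A \<Longrightarrow> finite (N a)"
    and v: "v \<in> A" and ab: "a \<in> N v" "b \<in> N v" "a \<noteq> b"
  shows "hall_family A (N(v := N v - {a})) \<or> hall_family A (N(v := N v - {b}))"
proof (rule ccontr)
  assume contr: "\<not> ?thesis"
  \<comment> \<open>A violation after removing \<open>d\<close> must involve \<open>v\<close>.
    Taking \<open>v\<close> out of the violating set lowers its size by one, so the strict
    inequality becomes \<open>\<le>\<close>.\<close>
  have step: "\<exists>P. finite P \<and> P \<subseteq> A \<and> v \<notin> P \<and> card ((\<Union>p\<in>P. N p) \<union> (N v - {d})) \<le> card P"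
    if "\<not> hall_family A (N(v := N v - {d}))" for d
  proof -
    obtain P where P: "finite P" "P \<subseteq> A" "card (\<Union>p\<in>P. (N(v := N v - {d})) p) < card P"
      using \<open>\<not> hall_family A (N(v := N v - {d}))\<close> by (auto simp: hall_family_def not_le)
    have "v \<in> P"
    proof (rule ccontr)
      assume "v \<notin> P"
      then have "(\<Union>p\<in>P. (N(v := N v - {d})) p) = (\<Union>p\<in>P. N p)" by auto
      then show False using hall_familyD[OF hall P(1,2)] P(3) by simp
    qed
    then have "(\<Union>p\<in>P. (N(v := N v - {d})) p) = (\<Union>p\<in>P - {v}. N p) \<union> (N v - {d})" by auto
    moreover have "card P = Suc (card (P - {v}))"
      using \<open>v \<in> P\<close> P(1) by (metis card_Suc_Diff1)
    ultimately have "card ((\<Union>p\<in>P - {v}. N p) \<union> (N v - {d})) \<le> card (P - {v})"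
      using P(3) by (metis less_Suc_eq_le)
    moreover have "finite (P - {v})" "P - {v} \<subseteq> A" "v \<notin> P - {v}" using P(1,2) by auto
    ultimately show ?thesis by blast
  qed
  obtain P where P: "finite P" "P \<subseteq> A" "v \<notin> P" "card ((\<Union>p\<in>P. N p) \<union> (N v - {a})) \<le> card P"
    using step contr by blast
  obtain Q where Q: "finite Q" "Q \<subseteq> A" "v \<notin> Q" "card ((\<Union>p\<in>Q. N p) \<union> (N v - {b})) \<le> card Q"
    using step contr by blast
  let ?X = "(\<Union>p\<in>P. N p) \<union> (N v - {a})" and ?Y = "(\<Union>p\<in>Q. N p) \<union> (N v - {b})"
  have finXY: "finite ?X" "finite ?Y"
    using P(1,2) Q(1,2) by (auto intro!: finite_UN_I fin v finite_Diff dest: subsetD)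
  \<comment> \<open>Inclusion-exclusion makes the two violations incompatible: Hall's condition for
    \<open>insert v (P \<union> Q)\<close> and for \<open>P \<inter> Q\<close> bounds
    \<open>card ?X + card ?Y\<close> below by \<open>card P + card Q + 1\<close>. Since
    \<open>a \<noteq> b\<close>, nothing of \<open>N v\<close> is lost in
    \<open>?X \<union> ?Y\<close>.\<close>
  have "card (P \<union> Q) + 1 = card (insert v (P \<union> Q))" using P Q by simp
  also have "\<dots> \<le> card (\<Union>p\<in>insert v (P \<union> Q). N p)"
    using P(1,2) Q(1,2) v by (intro hall_familyD[OF hall]) auto
  also have "(\<Union>p\<in>insert v (P \<union> Q). N p) = ?X \<union> ?Y"
  proof -
    have "N v = (N v - {a}) \<union> (N v - {b})" using ab(3) by blast
    then show ?thesis by auto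
  qed
  finally have 1: "card (P \<union> Q) + 1 \<le> card (?X \<union> ?Y)" .
  have "card (P \<inter> Q) \<le> card (\<Union>p\<in>P \<inter> Q. N p)"
    using P(1,2) Q(1,2) by (intro hall_familyD[OF hall]) auto
  also have "\<dots> \<le> card (?X \<inter> ?Y)" using finXY by (intro card_mono finite_Int UN_least) blast+
  finally have 2: "card (P \<inter> Q) \<le> card (?X \<inter> ?Y)" .
  have "card (?X \<union> ?Y) + card (?X \<inter> ?Y) = card ?X + card ?Y"
    using card_Un_Int[OF finXY] by (rule sym)
  moreover have "card (P \<union> Q) + card (P \<inter> Q) = card P + card Q"
    using card_Un_Int[OF P(1) Q(1)] by (rule sym)
  ultimately show False using 1 2 P(4) Q(4) by linarith
qed

text \<open>A member of least cardinality below the finite \<open>X0\<close> is comparable with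
  every other member and cannot properly contain one.\<close>

lemma finite_chain_Inter_attained:
  assumes "finite X0" "X0 \<in> \<C>" "\<And>X Y. X \<in> \<C> \<Longrightarrow> Y \<in> \<C> \<Longrightarrow> X \<subseteq> Y \<or> Y \<subseteq> X"
  shows "\<Inter>\<C> \<in> \<C>"
proof -
  define X where "X = arg_min card (\<lambda>Y. Y \<in> \<C> \<and> Y \<subseteq> X0)"
  have X: "X \<in> \<C>" "X \<subseteq> X0" and min: "\<And>Y. Y \<in> \<C> \<Longrightarrow> Y \<subseteq> X0 \<Longrightarrow> card X \<le> card Y"
    using arg_min_nat_lemma[of "\<lambda>Y. Y \<in> \<C> \<and> Y \<subseteq> X0" X0 card] assms(2) by (auto simp: X_def)
  have "X \<subseteq> Y" if "Y \<in> \<C>" for Y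
  proof (rule ccontr)
    assume "\<not> X \<subseteq> Y"
    then have "Y \<subset> X" using assms(3)[OF X(1) that] by auto
    then show False using min[OF that] X(2) assms(1)
      by (meson finite_subset not_le psubset_card_mono psubset_imp_subset subset_trans)
  qed
  then have "\<Inter>\<C> = X" using X(1) by blast
  then show ?thesis using X(1) by simp
qed

text \<open>Zorn's lemma for reverse inclusion gives a minimal Hall relation inside
  \<open>Sigma A N\<close>. By \<open>hall_family_remove\<close> each of its rows has a single
  element, and Hall's condition for pairs makes the resulting function injective.\<close>

theorem marriage_locally_finite:
  assumes hall: "hall_family A N" and fin: "\<And>a. a \<in> A \<Longrightarrow> finite (N a)"
  shows "\<exists>f. inj_on f A \<and> (\<forall>a\<in>A. f a \<in> N a)"
proof -
  define \<F> where "\<F> = {R. R \<subseteq> Sigma A N \<and> hall_family A (\<lambda>a. R `` {a})}"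
  have N: "Sigma A N \<in> \<F>"
  proof -
    have "(\<Union>p\<in>P. Sigma A N `` {p}) = (\<Union>p\<in>P. N p)" if "P \<subseteq> A" for P
      using that by auto
    then show ?thesis using hall by (auto simp: \<F>_def hall_family_def)
  qed
  have finR: "finite (R `` {a})" if "R \<in> \<F>" "a \<in> A" for R a
    using that fin[of a] by (auto simp: \<F>_def intro: finite_subset[of _ "N a"])
  have "\<exists>R\<in>\<F>. \<forall>R'\<in>\<F>. R' \<subseteq> R \<longrightarrow> R' = R"
  proof (rule predicate_Zorn[of \<F> "\<lambda>X Y. Y \<subseteq> X"])
    show "partial_order_on \<F> (relation_of (\<lambda>X Y. Y \<subseteq> X) \<F>)"
      by (rule partial_order_on_relation_ofI) (blast intro: subset_antisym)+
    fix \<C> assume "\<C> \<in> Chains (relation_of (\<lambda>X Y. Y \<subseteq> X) \<F>)"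
    then have C: "X \<in> \<F>" "X \<subseteq> Y \<or> Y \<subseteq> X" if "X \<in> \<C>" "Y \<in> \<C>" for X Y
      using that by (auto simp: Chains_def relation_of_def)
    show "\<exists>u\<in>\<F>. \<forall>R\<in>\<C>. u \<subseteq> R"
    proof (cases "\<C> = {}")
      case True
      then show ?thesis using N by auto
    next
      case False
      then obtain R0 where R0: "R0 \<in> \<C>" by blast
      have "card P \<le> card (\<Union>p\<in>P. \<Inter>\<C> `` {p})" if P: "finite P" "P \<subseteq> A" for P
      proof -
        \<comment> \<open>Hall's condition for \<open>P\<close> sees only the rows in
          \<open>P\<close>, which hold finitely many pairs; there the intersection of the chain
          agrees with one of its members and inherits the condition.\<close>
        let ?r = "\<lambda>R. R \<inter> P \<times> UNIV"
        have "\<Inter> (?r ` \<C>) \<in> ?r ` \<C>"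
        proof (rule finite_chain_Inter_attained)
          have "?r R0 \<subseteq> Sigma P N" using C(1)[OF R0 R0] by (auto simp: \<F>_def)
          then show "finite (?r R0)" using P fin by (meson finite_SigmaI finite_subset subsetD)
          show "?r R0 \<in> ?r ` \<C>" using R0 by blast
          fix X Y assume "X \<in> ?r ` \<C>" "Y \<in> ?r ` \<C>"
          then obtain X' Y' where XY: "X' \<in> \<C>" "Y' \<in> \<C>" "X = ?r X'" "Y = ?r Y'" by auto
          show "X \<subseteq> Y \<or> Y \<subseteq> X" using C(2)[OF XY(1,2)] unfolding XY(3,4) by auto
        qed
        then obtain R where R: "R \<in> \<C>" "\<Inter> (?r ` \<C>) = ?r R" by blast
        have "(\<Union>p\<in>P. \<Inter>\<C> `` {p}) = (\<Union>p\<in>P. R `` {p})"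
        proof (intro SUP_cong refl)
          fix p assume p: "p \<in> P"
          have "x \<in> \<Inter>\<C> `` {p} \<longleftrightarrow> (p, x) \<in> \<Inter> (?r ` \<C>)" for x using p R0 by auto
          also have "(p, x) \<in> \<Inter> (?r ` \<C>) \<longleftrightarrow> x \<in> R `` {p}" for x
            unfolding R(2) using p by auto
          finally show "\<Inter>\<C> `` {p} = R `` {p}" by blast
        qed
        then show ?thesis using C(1)[OF R(1) R(1)] P by (simp add: \<F>_def hall_family_def)
      qed
      moreover have "\<Inter>\<C> \<subseteq> Sigma A N" using C(1)[OF R0 R0] R0 by (auto simp: \<F>_def)
      ultimately have "\<Inter>\<C> \<in> \<F>" by (simp add: \<F>_def hall_family_def)
      then show ?thesis by blast
    qed
  qed
  then obtain R where R: "R \<in> \<F>" and min: "\<And>R'. R' \<in> \<F> \<Longrightarrow> R' \<subseteq> R \<Longrightarrow> R' = R" by blast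
  have hallR: "hall_family A (\<lambda>a. R `` {a})" and sub: "R \<subseteq> Sigma A N" using R by (auto simp: \<F>_def)
  have keep: "\<not> hall_family A ((\<lambda>x. R `` {x})(v := R `` {v} - {a}))" if "(v, a) \<in> R" for v a
  proof
    have "(\<lambda>x. (R - {(v, a)}) `` {x}) = (\<lambda>x. R `` {x})(v := R `` {v} - {a})"
      by (auto simp: fun_eq_iff)
    moreover assume "hall_family A ((\<lambda>x. R `` {x})(v := R `` {v} - {a}))"
    ultimately have "R - {(v, a)} \<in> \<F>" using sub by (auto simp: \<F>_def)
    then have "R - {(v, a)} = R" by (intro min Diff_subset)
    then show False using that by auto
  qed
  have uniq: "a = b" if "(v, a) \<in> R" "(v, b) \<in> R" for v a b
  proof (rule ccontr)
    assume "a \<noteq> b"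
    moreover have "v \<in> A" using that sub by blast
    ultimately show False
      using hall_family_remove[OF hallR finR[OF R], of v a b] keep[OF that(1)] keep[OF that(2)] that by simp
  qed
  have ex: "\<exists>a. (v, a) \<in> R" if "v \<in> A" for v
  proof (rule ccontr)
    assume "\<nexists>a. (v, a) \<in> R"
    then have "R `` {v} = {}" by auto
    moreover have "card {v} \<le> card (\<Union>p\<in>{v}. R `` {p})"
      using hall_familyD[OF hallR, of "{v}"] that by simp
    ultimately show False by simp
  qed
  define f where "f v = (THE a. (v, a) \<in> R)" for v
  have f: "(v, f v) \<in> R" if "v \<in> A" for v
    unfolding f_def by (rule theI', rule ex_ex1I[OF ex[OF that]], erule (1) uniq)
  have "inj_on f A"
  proof (rule inj_onI, rule ccontr)
    fix v w assume vw: "v \<in> A" "w \<in> A" "f v = f w" "v \<noteq> w"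
    have "(\<Union>p\<in>{v, w}. R `` {p}) = {f v}" 
    proof -
      have "R `` {x} = {f x}" if "x \<in> A" for x
      proof (intro equalityI subsetI)
        show "y \<in> {f x}" if "y \<in> R `` {x}" for y
          using uniq[OF _ f[OF \<open>x \<in> A\<close>]] that by simp
      qed (use f[OF that] in simp)
      from this[OF vw(1)] this[OF vw(2)] show ?thesis using vw(3) by simp
    qed
    moreover have "card {v, w} \<le> card (\<Union>p\<in>{v, w}. R `` {p})"
      using hall_familyD[OF hallR, of "{v, w}"] vw by simp
    ultimately show False using vw by simp
  qed
  then show ?thesis using f sub by (intro exI[of _ f]) auto
qed


section \<open>Invariant means\<close>

text \<open>Invariance is on the right because the vectors counted later are left translates by
  \<open>x\<close> of vectors supported in \<open>W\<close>: their supports lie in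
  \<open>x W\<close>, so mass moves by right multiplication.\<close>

locale right_mean = group H for H (structure) +
  fixes \<mu> :: "'a set \<Rightarrow> real"
  assumes mean_carrier: "\<mu> (carrier H) = 1"
    and mean_nonneg: "A \<subseteq> carrier H \<Longrightarrow> 0 \<le> \<mu> A"
    and mean_Un: "A \<subseteq> carrier H \<Longrightarrow> B \<subseteq> carrier H \<Longrightarrow> A \<inter> B = {} \<Longrightarrow> \<mu> (A \<union> B) = \<mu> A + \<mu> B"
    and mean_translate: "g \<in> carrier H \<Longrightarrow> A \<subseteq> carrier H \<Longrightarrow> \<mu> ((\<lambda>x. x \<otimes> g) ` A) = \<mu> A"
begin

lemma mean_mono: "A \<subseteq> B \<Longrightarrow> B \<subseteq> carrier H \<Longrightarrow> \<mu> A \<le> \<mu> B"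
proof -
  assume AB: "A \<subseteq> B" "B \<subseteq> carrier H"
  then have "A \<subseteq> carrier H" "B - A \<subseteq> carrier H" "A \<union> (B - A) = B" by blast+
  then show "\<mu> A \<le> \<mu> B" using mean_Un[of A "B - A"] mean_nonneg[of "B - A"] by simp
qed

lemma mean_empty: "\<mu> {} = 0"
  using mean_Un[of "{}" "{}"] by simp

lemma mean_UN_disjoint:
  assumes "finite I" "\<And>i. i \<in> I \<Longrightarrow> A i \<subseteq> carrier H" "disjoint_family_on A I"
  shows "\<mu> (\<Union>i\<in>I. A i) = (\<Sum>i\<in>I. \<mu> (A i))"
  using assms
proof (induction I rule: finite_induct)
  case empty
  then show ?case by (simp add: mean_empty)
next
  case (insert i I)
  have "A i \<inter> (\<Union>i\<in>I. A i) = {}"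
    using insert by (auto simp: disjoint_family_on_def)
  then have "\<mu> (A i \<union> (\<Union>i\<in>I. A i)) = \<mu> (A i) + \<mu> (\<Union>i\<in>I. A i)"
    using insert.prems by (intro mean_Un) auto
  then show ?case using insert by (simp add: disjoint_family_on_def)
qed

lemma mean_UN_le:
  assumes "finite I" "\<And>i. i \<in> I \<Longrightarrow> A i \<subseteq> carrier H"
  shows "\<mu> (\<Union>i\<in>I. A i) \<le> (\<Sum>i\<in>I. \<mu> (A i))"
  using assms
proof (induction I rule: finite_induct)
  case empty
  then show ?case by (simp add: mean_empty)
next
  case (insert i I)
  let ?R = "\<Union>i\<in>I. A i"
  have sub: "A i \<subseteq> carrier H" "?R \<subseteq> carrier H" using insert.prems by auto
  have "\<mu> (A i \<union> ?R) = \<mu> (A i \<union> (?R - A i))" by (simp add: Un_Diff_cancel)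
  also have "\<dots> = \<mu> (A i) + \<mu> (?R - A i)" using sub by (intro mean_Un) auto
  also have "\<dots> \<le> \<mu> (A i) + \<mu> ?R" using sub mean_mono[of "?R - A i" ?R] by auto
  finally show ?case using insert by simp
qed

end

text \<open>Inversion sends right translates to left translates, so composing a left invariant mean
  with it gives a right invariant one.\<close>

lemma amenable_right_mean:
  assumes "group H" "amenable H"
  shows "\<exists>\<mu>. right_mean H \<mu>"
proof -
  interpret group H by fact
  from assms(2) obtain \<mu> where \<mu>': "\<mu> (carrier H) = (1::real)"
      "\<forall>A. A \<subseteq> carrier H \<longrightarrow> \<mu> A \<ge> 0"
      "\<forall>A B. A \<subseteq> carrier H \<longrightarrow> B \<subseteq> carrier H \<longrightarrow> A \<inter> B = {} \<longrightarrow> \<mu> (A \<union> B) = \<mu> A + \<mu> B"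
      "\<forall>g A. g \<in> carrier H \<longrightarrow> A \<subseteq> carrier H \<longrightarrow> \<mu> (g <#\<^bsub>H\<^esub> A) = \<mu> A"
    unfolding amenable_def by (elim exE conjE) iprover
  note \<mu> = \<mu>'(1) \<mu>'(2-4)[rule_format]
  have "right_mean H (\<lambda>A. \<mu> (m_inv H ` A))"
  proof unfold_locales
    have "m_inv H ` carrier H = carrier H" 
    proof (intro equalityI subsetI)
      show "x \<in> m_inv H ` carrier H" if "x \<in> carrier H" for x
        using that by (intro image_eqI[of _ _ "inv\<^bsub>H\<^esub> x"]) simp_all
    qed auto
    then show "\<mu> (m_inv H ` carrier H) = 1" using \<mu>(1) by simp
    fix A assume A: "A \<subseteq> carrier H"
    then have A': "m_inv H ` A \<subseteq> carrier H" by auto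
    then show "0 \<le> \<mu> (m_inv H ` A)" using \<mu>(2) by blast
    { fix B assume B: "B \<subseteq> carrier H" "A \<inter> B = {}"
      have "m_inv H ` A \<inter> m_inv H ` B = {}"
        using inj_on_image_Int[OF inv_inj A B(1)] B(2) by simp
      moreover have "m_inv H ` B \<subseteq> carrier H" using B by auto
      ultimately show "\<mu> (m_inv H ` (A \<union> B)) = \<mu> (m_inv H ` A) + \<mu> (m_inv H ` B)"
        using \<mu>(3)[OF A'] by (simp add: image_Un) }
    fix g assume g: "g \<in> carrier H"
    have "m_inv H ` (\<lambda>x. x \<otimes>\<^bsub>H\<^esub> g) ` A = inv\<^bsub>H\<^esub> g <#\<^bsub>H\<^esub> (m_inv H ` A)"
      using A g by (force simp: l_coset_def image_iff inv_mult_group subset_iff)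
    then show "\<mu> (m_inv H ` (\<lambda>x. x \<otimes>\<^bsub>H\<^esub> g) ` A) = \<mu> (m_inv H ` A)"
      using \<mu>(4)[OF _ A'] g by simp
  qed
  then show ?thesis by blast
qed

section \<open>Convolution over amenable and initially subamenable groups\<close>

text \<open>The product of \<open>f\<close> with a matrix-valued function \<open>a\<close> placed on
  the right in the group variable; this side makes the operator commute with left
  translations.\<close>

definition group_conv ::
  "('g, 'c) monoid_scheme \<Rightarrow> 'g set \<Rightarrow> 'b set \<Rightarrow> ('g \<Rightarrow> 'b \<Rightarrow> 'b \<Rightarrow> 'k::field) \<Rightarrow> ('g \<times> 'b \<Rightarrow> 'k) \<Rightarrow> 'g \<Rightarrow> 'b \<Rightarrow> 'k"
  where "group_conv H U B a f g i = (\<Sum>u\<in>U. \<Sum>l\<in>B. a u i l * f (g \<otimes>\<^bsub>H\<^esub> inv\<^bsub>H\<^esub> u, l))"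

lemma group_conv_sum:
  "group_conv H U B a (\<lambda>y. \<Sum>p\<in>P. c p * w p y) g i = (\<Sum>p\<in>P. c p * group_conv H U B a (w p) g i)"
proof -
  have "group_conv H U B a (\<lambda>y. \<Sum>p\<in>P. c p * w p y) g i =
      (\<Sum>u\<in>U. \<Sum>l\<in>B. \<Sum>p\<in>P. c p * (a u i l * w p (g \<otimes>\<^bsub>H\<^esub> inv\<^bsub>H\<^esub> u, l)))"
    by (simp add: group_conv_def sum_distrib_left mult_ac)
  also have "\<dots> = (\<Sum>u\<in>U. \<Sum>p\<in>P. \<Sum>l\<in>B. c p * (a u i l * w p (g \<otimes>\<^bsub>H\<^esub> inv\<^bsub>H\<^esub> u, l)))"
    by (intro sum.cong refl sum.swap)
  also have "\<dots> = (\<Sum>p\<in>P. \<Sum>u\<in>U. \<Sum>l\<in>B. c p * (a u i l * w p (g \<otimes>\<^bsub>H\<^esub> inv\<^bsub>H\<^esub> u, l)))"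
    by (rule sum.swap)
  finally show ?thesis by (simp add: group_conv_def sum_distrib_left)
qed

lemma (in group) group_conv_translate:
  assumes "U \<subseteq> carrier G" "x \<in> carrier G" "g \<in> carrier G"
  shows "group_conv G U B a (\<lambda>(y, l). f (inv x \<otimes> y, l)) g i = group_conv G U B a f (inv x \<otimes> g) i"
  using assms unfolding group_conv_def
  by (intro sum.cong refl) (auto simp: m_assoc subset_iff)

lemma (in group) group_conv_eq_0:
  assumes "U \<subseteq> carrier G" "g \<in> carrier G" "\<And>h l. h \<in> carrier G \<Longrightarrow> l \<in> B \<Longrightarrow> f (h, l) = 0"
  shows "group_conv G U B a f g i = 0"
  using assms unfolding group_conv_def by (intro sum.neutral ballI) (auto simp: subset_iff)

text \<open>\<open>X\<close> is a maximal set whose translates \<open>x W\<close> are pairwise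
  disjoint. By maximality every \<open>g W\<close> meets some \<open>x W\<close>, so
  \<open>g = x \<otimes> (v \<otimes> inv w)\<close>. Separation keeps translates of a vector
  supported in \<open>W\<close> apart; for finite \<open>W\<close> the covering forces
  \<open>X\<close> to have positive mean.\<close>

lemma (in group) maximal_separated_subset:
  assumes "W \<subseteq> carrier G" "W \<noteq> {}"
  obtains X where "X \<subseteq> carrier G"
    "\<And>x y w v. x \<in> X \<Longrightarrow> y \<in> X \<Longrightarrow> w \<in> W \<Longrightarrow> v \<in> W \<Longrightarrow> x \<otimes> w = y \<otimes> v \<Longrightarrow> x = y"
    "carrier G \<subseteq> (\<Union>v\<in>W. \<Union>w\<in>W. (\<lambda>x. x \<otimes> (v \<otimes> inv w)) ` X)"
proof -
  define sep where "sep X \<longleftrightarrow> X \<subseteq> carrier G \<and>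
    (\<forall>x\<in>X. \<forall>y\<in>X. \<forall>w\<in>W. \<forall>v\<in>W. x \<otimes> w = y \<otimes> v \<longrightarrow> x = y)" for X
  have "\<exists>X\<in>Collect sep. \<forall>Y\<in>Collect sep. X \<subseteq> Y \<longrightarrow> Y = X"
  proof (rule subset_Zorn')
    fix \<C> assume ch: "subset.chain (Collect sep) \<C>"
    have "x = y" if "x \<in> X" "X \<in> \<C>" "y \<in> Y" "Y \<in> \<C>" "w \<in> W" "v \<in> W" "x \<otimes> w = y \<otimes> v"
      for x X y Y w v
    proof -
      note * = that
      obtain Z where "Z \<in> \<C>" "x \<in> Z" "y \<in> Z"
        using ch *(1-4) unfolding subset_chain_def by blast
      moreover have "sep Z" using ch \<open>Z \<in> \<C>\<close> by (auto simp: subset_chain_def)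
      ultimately show ?thesis using *(5-7) unfolding sep_def by blast
    qed
    moreover have "\<Union>\<C> \<subseteq> carrier G"
      using ch unfolding subset_chain_def sep_def by blast
    ultimately show "\<Union>\<C> \<in> Collect sep" unfolding sep_def by blast
  qed
  then obtain X where X: "sep X" and max: "\<And>Y. sep Y \<Longrightarrow> X \<subseteq> Y \<Longrightarrow> Y = X" by blast
  have XG: "X \<subseteq> carrier G" using X by (simp add: sep_def)
  have "g \<in> (\<Union>v\<in>W. \<Union>w\<in>W. (\<lambda>x. x \<otimes> (v \<otimes> inv w)) ` X)" if g: "g \<in> carrier G" for g
  proof (cases "\<exists>x\<in>X. \<exists>w\<in>W. \<exists>v\<in>W. g \<otimes> w = x \<otimes> v")
    case True
    then obtain x w v where x: "x \<in> X" "w \<in> W" "v \<in> W" "g \<otimes> w = x \<otimes> v" by blast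
    then have c: "x \<in> carrier G" "w \<in> carrier G" "v \<in> carrier G" using XG assms by auto
    have "g = (g \<otimes> w) \<otimes> inv w" using c g by (simp add: m_assoc)
    also have "\<dots> = x \<otimes> (v \<otimes> inv w)" using c x by (simp add: m_assoc)
    finally show ?thesis using x by blast
  next
    case False
    have "sep (insert g X)"
      unfolding sep_def
    proof (intro conjI ballI impI)
      show "insert g X \<subseteq> carrier G" using g XG by auto
      fix x y w v assume *: "x \<in> insert g X" "y \<in> insert g X" "w \<in> W" "v \<in> W" "x \<otimes> w = y \<otimes> v"
      show "x = y"
      proof (cases "x \<in> X \<and> y \<in> X")
        case True
        then show ?thesis using X * unfolding sep_def by blast
      next
        case nXX: False
        then show ?thesis using * False by (metis insert_iff)
      qed
    qed
    then have "g \<in> X" using max by blast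
    obtain w where "w \<in> W" using assms by blast
    moreover from this have "g = g \<otimes> (w \<otimes> inv w)" using assms g by (simp add: subset_iff)
    ultimately show ?thesis using \<open>g \<in> X\<close> by blast
  qed
  then show thesis using that[of X] X XG unfolding sep_def by blast
qed

text \<open>A locally bounded injection of \<open>carrier H \<times> B \<union> X \<times> {None}\<close> into \<open>carrier H \<times> B\<close>
  moves mass by right translations only, so it leaves no room for \<open>X\<close>.\<close>
lemma (in right_mean) mean_zero_of_injection:
  assumes B: "finite B" and W: "finite W" "W \<subseteq> carrier H" and X: "X \<subseteq> carrier H"
    and inj: "inj_on \<Phi> (carrier H \<times> Some ` B \<union> X \<times> {None})"
    and \<Phi>: "\<And>x d. (x, d) \<in> carrier H \<times> Some ` B \<union> X \<times> {None} \<Longrightarrow>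
              \<Phi> (x, d) \<in> (\<lambda>w. x \<otimes> w) ` W \<times> B"
  shows "\<mu> X = 0"
proof -
  let ?D = "insert None (Some ` B)"
  define S where "S d = (if d = None then X else carrier H)" for d :: "'c option"
  have S: "S d \<subseteq> carrier H" for d using X by (simp add: S_def)
  have dom: "(x, d) \<in> carrier H \<times> Some ` B \<union> X \<times> {None} \<longleftrightarrow> d \<in> ?D \<and> x \<in> S d" for x d
    by (auto simp: S_def)
  \<comment> \<open>The points of type \<open>d\<close> that are moved by \<open>w\<close> into
    layer \<open>i\<close>. Pieces with fixed \<open>d\<close> cover \<open>S d\<close>, while the
    right translates of those with fixed \<open>i\<close> are disjoint, so their means can be summed
    in either order.\<close>
  define P where "P d w i = {x \<in> S d. \<Phi> (x, d) = (x \<otimes> w, i)}" for d w i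
  have P: "P d w i \<subseteq> carrier H" for d w i using S by (auto simp: P_def)
  have le1: "\<mu> (S d) \<le> (\<Sum>w\<in>W. \<Sum>i\<in>B. \<mu> (P d w i))" if "d \<in> ?D" for d
  proof -
    have "S d = (\<Union>(w, i)\<in>W \<times> B. P d w i)"
    proof (intro equalityI subsetI)
      fix x assume x: "x \<in> S d"
      then have "\<Phi> (x, d) \<in> (\<lambda>w. x \<otimes> w) ` W \<times> B" using dom that by (intro \<Phi>) blast
      then show "x \<in> (\<Union>(w, i)\<in>W \<times> B. P d w i)" using x by (auto simp: P_def)
    qed (auto simp: P_def)
    also have "\<mu> \<dots> \<le> (\<Sum>(w, i)\<in>W \<times> B. \<mu> (P d w i))"
      using B W P mean_UN_le[of "W \<times> B" "\<lambda>(w, i). P d w i"] by (auto simp: case_prod_unfold)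
    finally show ?thesis by (simp add: sum.cartesian_product)
  qed
  have le2: "(\<Sum>d\<in>?D. \<Sum>w\<in>W. \<mu> (P d w i)) \<le> 1" if "i \<in> B" for i
  proof -
    let ?T = "\<lambda>(d, w). (\<lambda>x. x \<otimes> w) ` P d w i"
    have T: "?T q \<subseteq> carrier H" if "q \<in> ?D \<times> W" for q
      using P W that by (fastforce simp: subset_iff)
    have "disjoint_family_on ?T (?D \<times> W)"
      unfolding disjoint_family_on_def
    proof (intro ballI impI, clarsimp simp: disjoint_iff)
      fix d w d' w' x x'
      assume *: "d = None \<or> d \<in> Some ` B" "w \<in> W" "d' = None \<or> d' \<in> Some ` B" "w' \<in> W"
        "d = d' \<longrightarrow> w \<noteq> w'" "x \<in> P d w i" "x' \<in> P d' w' i" "x \<otimes> w = x' \<otimes> w'"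
      then have "\<Phi> (x, d) = \<Phi> (x', d')" by (simp add: P_def)
      moreover have "x \<in> S d" "x' \<in> S d'" using * by (auto simp: P_def)
      ultimately have eq: "x = x'" "d = d'"
        using inj_onD[OF inj, of "(x, d)" "(x', d')"] * dom by auto
      then have "w = w'" using * W P by (metis Units_eq Units_l_cancel subsetD)
      then show False using eq * by blast
    qed
    then have "(\<Sum>q\<in>?D \<times> W. \<mu> (?T q)) = \<mu> (\<Union>q\<in>?D \<times> W. ?T q)"
      using B W T by (subst mean_UN_disjoint) auto
    also have "\<dots> \<le> 1" using mean_mono[of "\<Union>q\<in>?D \<times> W. ?T q" "carrier H"] UN_least[of "?D \<times> W" ?T, OF T] mean_carrier
      by simp
    finally have "(\<Sum>(d, w)\<in>?D \<times> W. \<mu> ((\<lambda>x. x \<otimes> w) ` P d w i)) \<le> 1"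
      by (simp add: case_prod_unfold)
    moreover have "(\<Sum>(d, w)\<in>?D \<times> W. \<mu> ((\<lambda>x. x \<otimes> w) ` P d w i)) = (\<Sum>(d, w)\<in>?D \<times> W. \<mu> (P d w i))"
      using P W by (intro sum.cong refl) (auto simp: mean_translate subset_iff)
    ultimately show ?thesis by (simp add: sum.cartesian_product)
  qed
  \<comment> \<open>Each layer \<open>Some j\<close> of the domain has mean 1 and each layer of the
    target holds mass at most 1, so \<open>\<mu> X\<close> is the surplus.\<close>
  have "\<mu> X + card B = (\<Sum>d\<in>?D. \<mu> (S d))"
    using B by (simp add: S_def sum.reindex mean_carrier)
  also have "\<dots> \<le> (\<Sum>d\<in>?D. \<Sum>w\<in>W. \<Sum>i\<in>B. \<mu> (P d w i))"
    by (intro sum_mono le1)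
  also have "\<dots> = (\<Sum>d\<in>?D. \<Sum>i\<in>B. \<Sum>w\<in>W. \<mu> (P d w i))"
    by (intro sum.cong refl sum.swap)
  also have "\<dots> = (\<Sum>i\<in>B. \<Sum>d\<in>?D. \<Sum>w\<in>W. \<mu> (P d w i))"
    by (rule sum.swap)
  also have "\<dots> \<le> (\<Sum>i\<in>B. 1)" by (intro sum_mono le2)
  finally have "\<mu> X \<le> 0" by simp
  then show ?thesis using mean_nonneg[OF X] by simp
qed


text \<open>If the kernel contained \<open>z \<noteq> 0\<close>, then the left translates of the columns \<open>b j\<close> together with
  the translates of \<open>z\<close> along a separated syndetic set \<open>X\<close> would form a linearly independent family
  of uniformly local vectors. The marriage theorem turns it into an injection that contradicts
  the invariance of the mean.\<close>
lemma group_conv_kernel_trivial_amenable: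
  fixes H :: "('h, 'c) monoid_scheme" (structure)
    and a :: "'h \<Rightarrow> 'b \<Rightarrow> 'b \<Rightarrow> 'k::field"
    and b :: "'b \<Rightarrow> 'h \<times> 'b \<Rightarrow> 'k"
  assumes H: "group H" "amenable H" and U: "U \<subseteq> carrier H"
    and B: "finite B" and W: "finite W" "W \<subseteq> carrier H"
    and b: "\<And>j g l. j \<in> B \<Longrightarrow> b j (g, l) \<noteq> 0 \<Longrightarrow> g \<in> W"
    and conv_b: "\<And>j g i. j \<in> B \<Longrightarrow> g \<in> carrier H \<Longrightarrow> i \<in> B \<Longrightarrow>
          group_conv H U B a (b j) g i = (if g = \<one> \<and> i = j then 1 else 0)"
    and z: "\<And>g l. z (g, l) \<noteq> 0 \<Longrightarrow> g \<in> W"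
    and conv_z: "\<And>g i. g \<in> carrier H \<Longrightarrow> i \<in> B \<Longrightarrow> group_conv H U B a z g i = 0"
    and g0: "g0 \<in> carrier H" and l0: "l0 \<in> B"
  shows "z (g0, l0) = 0"
proof (rule ccontr)
  assume nz: "z (g0, l0) \<noteq> 0"
  interpret group H by fact
  obtain \<mu> where "right_mean H \<mu>" using amenable_right_mean[OF H] by blast
  then interpret right_mean H \<mu> .
  have g0W: "g0 \<in> W" using z[OF nz] .
  then have "W \<noteq> {}" by blast
  obtain X where X: "X \<subseteq> carrier H"
    and sep: "\<And>x y w v. x \<in> X \<Longrightarrow> y \<in> X \<Longrightarrow> w \<in> W \<Longrightarrow> v \<in> W \<Longrightarrow> x \<otimes> w = y \<otimes> v \<Longrightarrow> x = y"
    and cover: "carrier H \<subseteq> (\<Union>v\<in>W. \<Union>w\<in>W. (\<lambda>x. x \<otimes> (v \<otimes> inv w)) ` X)"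
    by (rule maximal_separated_subset[OF W(2) \<open>W \<noteq> {}\<close>]) (rule that)
  let ?A = "carrier H \<times> Some ` B \<union> X \<times> {None}"
  define N where "N p = (\<lambda>w. fst p \<otimes> w) ` W \<times> B" for p :: "'h \<times> 'b option"
  define \<beta> where "\<beta> d = (case d of None \<Rightarrow> z | Some j \<Rightarrow> b j)" for d
  define w where "w p = (\<lambda>(y, l). \<beta> (snd p) (inv (fst p) \<otimes> y, l))" for p
  have A: "fst p \<in> carrier H" if "p \<in> ?A" for p using that X by auto
  have w_supp: "(y, l) \<in> N p" if "p \<in> ?A" "y \<in> carrier H" "l \<in> B" "w p (y, l) \<noteq> 0" for p y l
  proof -
    have "inv (fst p) \<otimes> y \<in> W"
      using that(1,4) b z by (auto simp: w_def \<beta>_def split: option.splits)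
    moreover have "y = fst p \<otimes> (inv (fst p) \<otimes> y)"
      using A[OF that(1)] that(2) by (simp add: m_assoc[symmetric])
    ultimately show ?thesis using that(3) by (auto simp: N_def)
  qed
  \<comment> \<open>Convolution extracts coefficients: it sends the translated column with index
    \<open>(g, Some i)\<close> to the unit vector at \<open>(g, i)\<close> and kills the translates
    of \<open>z\<close>.\<close>
  have conv_w: "group_conv H U B a (w p) g i = (if p = (g, Some i) then 1 else 0)"
    if p: "p \<in> ?A" and g: "g \<in> carrier H" and i: "i \<in> B" for p g i
  proof -
    have "group_conv H U B a (w p) g i = group_conv H U B a (\<beta> (snd p)) (inv (fst p) \<otimes> g) i"
      unfolding w_def by (rule group_conv_translate[OF U A[OF p] g])
    also have "\<dots> = (if p = (g, Some i) then 1 else 0)"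
    proof (cases "snd p")
      case None
      then show ?thesis using A[OF p] g i conv_z by (cases p) (auto simp: \<beta>_def)
    next
      case (Some j)
      then have "j \<in> B" using p by auto
      moreover have "inv (fst p) \<otimes> g = \<one> \<longleftrightarrow> fst p = g"
        using A[OF p] g by (metis inv_closed inv_comm inv_equality inv_inv l_inv)
      ultimately show ?thesis using A[OF p] g i Some conv_b by (cases p) (auto simp: \<beta>_def)
    qed
    finally show ?thesis .
  qed
  have "hall_family ?A N"
    unfolding hall_family_def
  proof (intro allI impI, rule ccontr)
    fix P assume P: "finite P" "P \<subseteq> ?A" and "\<not> card P \<le> card (\<Union>p\<in>P. N p)"
    moreover have "finite (\<Union>p\<in>P. N p)" using P(1) W(1) B by (simp add: N_def)
    ultimately obtain c where c: "\<exists>p\<in>P. c p \<noteq> 0"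
        and hom: "\<forall>y\<in>(\<Union>p\<in>P. N p). (\<Sum>p\<in>P. c p * w p y) = 0"
      using homogeneous_system_nontrivial[of "\<Union>p\<in>P. N p" P w] by auto
    \<comment> \<open>Outside the union of the \<open>N p\<close> all vectors indexed by
      \<open>P\<close> vanish, so a relation imposed on these finitely many coordinates holds on all
      of \<open>carrier H \<times> B\<close>.\<close>
    have rel: "(\<Sum>p\<in>P. c p * w p (y, l)) = 0" if yl: "y \<in> carrier H" "l \<in> B" for y l
    proof (cases "(y, l) \<in> (\<Union>p\<in>P. N p)")
      case True
      then show ?thesis using hom by blast
    next
      case False
      then have "w p (y, l) = 0" if "p \<in> P" for p
        using w_supp[OF _ yl, of p] P(2) that by blast
      then show ?thesis by simp
    qed
    have c_Some: "c (g, Some i) = 0" if "(g, Some i) \<in> P" for g i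
    proof -
      have gi: "g \<in> carrier H" "i \<in> B" using that P by auto
      have "group_conv H U B a (\<lambda>y. \<Sum>p\<in>P. c p * w p y) g i = 0"
        by (rule group_conv_eq_0[OF U gi(1)]) (rule rel)
      then have "0 = group_conv H U B a (\<lambda>y. \<Sum>p\<in>P. c p * w p y) g i" by simp
      also have "\<dots> = (\<Sum>p\<in>P. c p * (if p = (g, Some i) then 1 else 0))"
        unfolding group_conv_sum
        by (intro sum.cong refl) (simp only: conv_w[OF subsetD[OF P(2)] gi])
      also have "\<dots> = c (g, Some i)" using P(1) that by (simp add: if_distrib sum.delta cong: if_cong)
      finally show ?thesis by simp
    qed
    obtain p where p: "p \<in> P" "c p \<noteq> 0" using c by blast
    obtain x where x: "p = (x, None)" "x \<in> X"
    proof (cases "snd p")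
      case None
      then show thesis using that[of "fst p"] p(1) P(2) by (cases p) auto
    next
      case (Some i)
      then have "c p = 0" using c_Some[of "fst p" i] p(1) by (cases p) simp
      then show thesis using p(2) by contradiction
    qed
    have xH: "x \<in> carrier H" using x X by auto
    \<comment> \<open>The point \<open>x \<otimes> g0\<close> isolates \<open>p\<close>: the columns
      already have coefficient 0, and the separation of \<open>X\<close> keeps every other translate
      of \<open>z\<close> away from this point.\<close>
    have "c q * w q (x \<otimes> g0, l0) = 0" if q: "q \<in> P" "q \<noteq> p" for q
    proof (cases "snd q")
      case (Some j)
      then show ?thesis using c_Some[of "fst q" j] q by (cases q) auto
    next
      case None
      then have y: "fst q \<in> X" "q = (fst q, None)" using q P(2) by (cases q; auto)+
      have "w q (x \<otimes> g0, l0) = 0"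
      proof (rule ccontr)
        assume "w q (x \<otimes> g0, l0) \<noteq> 0"
        then have "(x \<otimes> g0, l0) \<in> N q" using w_supp q P(2) xH g0 l0 by blast
        then obtain v where "v \<in> W" "x \<otimes> g0 = fst q \<otimes> v" by (auto simp: N_def)
        then have "x = fst q" using sep[OF x(2) y(1) g0W] by blast
        then show False using q(2) x(1) y(2) by simp
      qed
      then show ?thesis by simp
    qed
    then have "(\<Sum>q\<in>P - {p}. c q * w q (x \<otimes> g0, l0)) = 0"
      by (intro sum.neutral) blast
    then have "(\<Sum>q\<in>P. c q * w q (x \<otimes> g0, l0)) = c p * w p (x \<otimes> g0, l0)"
      using sum.remove[OF P(1) p(1), of "\<lambda>q. c q * w q (x \<otimes> g0, l0)"] by simp
    moreover have "w p (x \<otimes> g0, l0) = z (g0, l0)"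
      using x xH g0 by (simp add: w_def \<beta>_def m_assoc[symmetric])
    ultimately show False using rel[of "x \<otimes> g0" l0] p(2) nz xH g0 l0 by simp
  qed
  then obtain \<Phi> where "inj_on \<Phi> ?A" "\<And>p. p \<in> ?A \<Longrightarrow> \<Phi> p \<in> N p"
    using marriage_locally_finite[of ?A N] W(1) B by (auto simp: N_def)
  then have X0: "\<mu> X = 0"
    by (intro mean_zero_of_injection[OF B W X]) (auto simp: N_def)
  have sub: "(\<lambda>x. x \<otimes> (v \<otimes> inv w)) ` X \<subseteq> carrier H" if "v \<in> W" "w \<in> W" for v w
    using that W X by (auto simp: subset_iff)
  \<comment> \<open>Finitely many right translates of the null set \<open>X\<close> would exhaust a
    space of mean 1.\<close>
  have "1 = \<mu> (\<Union>v\<in>W. \<Union>w\<in>W. (\<lambda>x. x \<otimes> (v \<otimes> inv w)) ` X)"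
    using cover sub by (subst mean_carrier[symmetric]) (intro arg_cong[where f = \<mu>] equalityI UN_least)
  also have "\<dots> \<le> (\<Sum>v\<in>W. \<mu> (\<Union>w\<in>W. (\<lambda>x. x \<otimes> (v \<otimes> inv w)) ` X))"
    using W sub by (intro mean_UN_le UN_least)
  also have "\<dots> \<le> (\<Sum>v\<in>W. \<Sum>w\<in>W. \<mu> ((\<lambda>x. x \<otimes> (v \<otimes> inv w)) ` X))"
    using W sub by (intro sum_mono mean_UN_le)
  also have "\<dots> = 0"
    using W X X0 by (intro sum.neutral ballI) (auto simp: mean_translate subset_iff)
  finally show False by simp
qed


section \<open>Transport along a locally multiplicative map\<close>

text \<open>A map that is multiplicative on a finite set gives no control of inverses lying outside
  it. Indexing the sum by the factorisations \<open>w \<otimes> u = g\<close> leaves only products,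
  which such a map can preserve.\<close>

lemma (in group) group_conv_double_sum:
  assumes U: "U \<subseteq> carrier G" and W: "finite W" "W \<subseteq> carrier G"
    and f: "\<And>h l. f (h, l) \<noteq> 0 \<Longrightarrow> h \<in> W" and g: "g \<in> carrier G"
  shows "group_conv G U B a f g i =
    (\<Sum>u\<in>U. \<Sum>w\<in>W. if w \<otimes> u = g then \<Sum>l\<in>B. a u i l * f (w, l) else 0)"
  unfolding group_conv_def
proof (intro sum.cong refl)
  fix u assume "u \<in> U"
  then have u: "u \<in> carrier G" using U by blast
  have eq: "w \<otimes> u = g \<longleftrightarrow> w = g \<otimes> inv u" if "w \<in> W" for w
    using that W(2) u g by (metis inv_solve_right subsetD)
  have "(\<Sum>w\<in>W. if w \<otimes> u = g then \<Sum>l\<in>B. a u i l * f (w, l) else 0)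
      = (\<Sum>w\<in>W. if w = g \<otimes> inv u then \<Sum>l\<in>B. a u i l * f (w, l) else 0)"
    using eq by (intro sum.cong) auto
  also have "\<dots> = (if g \<otimes> inv u \<in> W then \<Sum>l\<in>B. a u i l * f (g \<otimes> inv u, l) else 0)"
    using W(1) by (simp add: sum.delta')
  also have "\<dots> = (\<Sum>l\<in>B. a u i l * f (g \<otimes> inv u, l))"
  proof (cases "g \<otimes> inv u \<in> W")
    case False
    then have "f (g \<otimes> inv u, l) = 0" for l using f by blast
    then show ?thesis by simp
  qed simp
  finally show "(\<Sum>l\<in>B. a u i l * f (g \<otimes> inv u, l))
      = (\<Sum>w\<in>W. if w \<otimes> u = g then \<Sum>l\<in>B. a u i l * f (w, l) else 0)" ..
qed

text \<open>The convolution of a vector supported in \<open>W\<close> lives on the products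
  \<open>w \<otimes> u\<close>. The identities for \<open>b\<close> and \<open>z\<close> therefore
  survive in an amenable group as soon as these products lie in the domain \<open>E\<close> of the
  local embedding.\<close>

lemma group_conv_kernel_trivial:
  fixes G :: "('g, 'c) monoid_scheme" (structure)
    and a :: "'g \<Rightarrow> 'b \<Rightarrow> 'b \<Rightarrow> 'k::field"
    and b :: "'b \<Rightarrow> 'g \<times> 'b \<Rightarrow> 'k"
  assumes G: "group G" "initially_subamenable TYPE('h) G" and U: "finite U" "U \<subseteq> carrier G"
    and B: "finite B" and W: "finite W" "W \<subseteq> carrier G"
    and b: "\<And>j g l. j \<in> B \<Longrightarrow> b j (g, l) \<noteq> 0 \<Longrightarrow> g \<in> W"
    and conv_b: "\<And>j g i. j \<in> B \<Longrightarrow> g \<in> carrier G \<Longrightarrow> i \<in> B \<Longrightarrow>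
          group_conv G U B a (b j) g i = (if g = \<one> \<and> i = j then 1 else 0)"
    and z: "\<And>g l. z (g, l) \<noteq> 0 \<Longrightarrow> g \<in> W"
    and conv_z: "\<And>g i. g \<in> carrier G \<Longrightarrow> i \<in> B \<Longrightarrow> group_conv G U B a z g i = 0"
    and g0: "g0 \<in> carrier G" and l0: "l0 \<in> B"
  shows "z (g0, l0) = 0"
proof -
  interpret group G by fact
  define E where "E = U \<union> W \<union> {\<one>} \<union> (\<lambda>(w, u). w \<otimes> u) ` (W \<times> U)"
  have E: "finite E" "E \<subseteq> carrier G" "U \<subseteq> E" "W \<subseteq> E" "\<one> \<in> E"
    and WU: "\<And>w u. w \<in> W \<Longrightarrow> u \<in> U \<Longrightarrow> w \<otimes> u \<in> E"
    using U W by (auto simp: E_def)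
  obtain H :: "'h monoid" and \<phi> where H: "group H" "amenable H"
    and \<phi>: "\<phi> \<in> E \<rightarrow> carrier H" "inj_on \<phi> E"
    and hom: "\<And>g h. g \<in> E \<Longrightarrow> h \<in> E \<Longrightarrow> g \<otimes> h \<in> E \<Longrightarrow> \<phi> (g \<otimes> h) = \<phi> g \<otimes>\<^bsub>H\<^esub> \<phi> h"
    using G(2) E(1,2) unfolding initially_subamenable_def by metis
  interpret H: group H by fact
  \<comment> \<open>The image of \<open>\<one>\<close> is idempotent, because
    \<open>\<one> \<otimes> \<one>\<close> stays in \<open>E\<close>.\<close>
  have \<phi>_one: "\<phi> \<one> = \<one>\<^bsub>H\<^esub>"
    using hom[OF E(5,5)] \<phi>(1) E(5) by (metis H.r_cancel_one PiE l_one one_closed)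
  define \<psi> where "\<psi> = inv_into E \<phi>"
  have \<psi>: "\<psi> (\<phi> g) = g" if "g \<in> E" for g
    using \<phi>(2) that by (simp add: \<psi>_def)
  define push where "push f = (\<lambda>(h, l). if h \<in> \<phi> ` W then f (\<psi> h, l) else 0)"
    for f :: "'g \<times> 'b \<Rightarrow> 'k"
  have sub: "\<phi> ` U \<subseteq> carrier H" "\<phi> ` W \<subseteq> carrier H" using \<phi>(1) E by auto
  \<comment> \<open>All products \<open>w \<otimes> u\<close> stay in \<open>E\<close>, where
    \<open>\<phi>\<close> is injective. Hence the factorisations of \<open>\<phi> g\<close> into
    images of \<open>W\<close> and \<open>U\<close> are those of \<open>g\<close>, and points
    outside the image of \<open>E\<close> have none.\<close>
  have conv_push: "group_conv H (\<phi> ` U) B (\<lambda>u. a (\<psi> u)) (push f) g' i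
      = (if g' \<in> \<phi> ` E then group_conv G U B a f (\<psi> g') i else 0)"
    if f: "\<And>h l. f (h, l) \<noteq> 0 \<Longrightarrow> h \<in> W" and g': "g' \<in> carrier H" for f g' i
  proof -
    have "group_conv H (\<phi> ` U) B (\<lambda>u. a (\<psi> u)) (push f) g' i
        = (\<Sum>u\<in>\<phi> ` U. \<Sum>w\<in>\<phi> ` W. if w \<otimes>\<^bsub>H\<^esub> u = g' then \<Sum>l\<in>B. a (\<psi> u) i l * push f (w, l) else 0)"
      using W(1) sub g'
      by (intro H.group_conv_double_sum) (auto simp: push_def split: if_splits)
    also have "\<dots> = (\<Sum>u\<in>U. \<Sum>w\<in>W. if \<phi> w \<otimes>\<^bsub>H\<^esub> \<phi> u = g'
        then \<Sum>l\<in>B. a (\<psi> (\<phi> u)) i l * push f (\<phi> w, l) else 0)"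
      using inj_on_subset[OF \<phi>(2) E(3)] inj_on_subset[OF \<phi>(2) E(4)] by (simp add: sum.reindex)
    also have "\<dots> = (\<Sum>u\<in>U. \<Sum>w\<in>W. if \<phi> (w \<otimes> u) = g'
        then \<Sum>l\<in>B. a u i l * f (w, l) else 0)"
    proof (intro sum.cong refl if_cong)
      fix u w assume "u \<in> U" "w \<in> W"
      then have uw: "u \<in> E" "w \<in> E" "w \<otimes> u \<in> E" using E WU by auto
      show "\<phi> w \<otimes>\<^bsub>H\<^esub> \<phi> u = g' \<longleftrightarrow> \<phi> (w \<otimes> u) = g'" using hom uw by simp
      show "a (\<psi> (\<phi> u)) i l * push f (\<phi> w, l) = a u i l * f (w, l)" for l
        using uw \<psi> \<open>w \<in> W\<close> by (simp add: push_def)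
    qed
    also have "\<dots> = (if g' \<in> \<phi> ` E then group_conv G U B a f (\<psi> g') i else 0)"
    proof (cases "g' \<in> \<phi> ` E")
      case False
      then show ?thesis using WU by (auto intro!: sum.neutral)
    next
      case True
      then obtain g where g: "g \<in> E" "g' = \<phi> g" by blast
      have "\<phi> (w \<otimes> u) = g' \<longleftrightarrow> w \<otimes> u = g" if "u \<in> U" "w \<in> W" for u w
        using WU[OF that(2,1)] g \<phi>(2) by (auto dest: inj_onD)
      then have "(\<Sum>u\<in>U. \<Sum>w\<in>W. if \<phi> (w \<otimes> u) = g' then \<Sum>l\<in>B. a u i l * f (w, l) else 0)
        = (\<Sum>u\<in>U. \<Sum>w\<in>W. if w \<otimes> u = g then \<Sum>l\<in>B. a u i l * f (w, l) else 0)"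
        by (intro sum.cong refl if_cong) auto
      also have "\<dots> = group_conv G U B a f g i"
        using U(2) W f g(1) E(2) by (intro group_conv_double_sum[symmetric]) auto
      finally show ?thesis using True \<psi>[OF g(1)] g(2) by simp
    qed
    finally show ?thesis .
  qed
  show ?thesis
  proof (cases "g0 \<in> W")
    case False
    then show ?thesis using z by blast
  next
    case True
    have "push z (\<phi> g0, l0) = 0"
    proof (rule group_conv_kernel_trivial_amenable[OF H sub(1) B _ sub(2)])
      show "finite (\<phi> ` W)" using W(1) by simp
      show "g \<in> \<phi> ` W" if "push (b j) (g, l) \<noteq> 0" for g l j
        using that by (auto simp: push_def split: if_splits)
      show "g \<in> \<phi> ` W" if "push z (g, l) \<noteq> 0" for g l
        using that by (auto simp: push_def split: if_splits)
      show "\<phi> g0 \<in> carrier H" using True sub by auto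
      show "l0 \<in> B" by fact
      show "group_conv H (\<phi> ` U) B (\<lambda>u. a (\<psi> u)) (push z) g i = 0"
        if "g \<in> carrier H" "i \<in> B" for g i
        using conv_push[OF z that(1)] conv_z that(2) \<psi> E(2) by auto
      show "group_conv H (\<phi> ` U) B (\<lambda>u. a (\<psi> u)) (push (b j)) g i = (if g = \<one>\<^bsub>H\<^esub> \<and> i = j then 1 else 0)"
        if "j \<in> B" "g \<in> carrier H" "i \<in> B" for g i j
      proof (cases "g \<in> \<phi> ` E")
        case True
        then obtain g1 where g1: "g1 \<in> E" "g = \<phi> g1" by blast
        then have "g = \<one>\<^bsub>H\<^esub> \<longleftrightarrow> g1 = \<one>"
          using \<phi>_one \<phi>(2) E(5) by (metis inj_onD)
        then show ?thesis
          using conv_push[OF b[OF that(1)] that(2)] True conv_b[OF that(1) _ that(3)] \<psi> g1 E(2) by auto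
      next
        case False
        then have "g \<noteq> \<one>\<^bsub>H\<^esub>" using \<phi>_one E(5) by (metis imageI)
        then show ?thesis using conv_push[OF b[OF that(1)] that(2)] False by simp
      qed
    qed
    then show ?thesis using True \<psi> E(4) by (auto simp: push_def)
  qed
qed

section \<open>Residual finiteness as a special case\<close>

lemma finite_group_amenable:
  assumes "group H" "finite (carrier H)"
  shows "amenable H"
proof -
  interpret group H by fact
  have "carrier H \<noteq> {}" using one_closed by blast
  then have pos: "card (carrier H) > 0" using assms(2) by (simp add: card_gt_0_iff)
  define \<mu> where "\<mu> A = real (card A) / real (card (carrier H))" for A :: "'a set"
  have "\<mu> (A \<union> B) = \<mu> A + \<mu> B" if "A \<subseteq> carrier H" "B \<subseteq> carrier H" "A \<inter> B = {}" for A B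
    using that assms(2) by (simp add: \<mu>_def card_Un_disjoint finite_subset add_divide_distrib)
  moreover have "\<mu> (g <#\<^bsub>H\<^esub> A) = \<mu> A" if "g \<in> carrier H" "A \<subseteq> carrier H" for g A
  proof -
    have "g <#\<^bsub>H\<^esub> A = (\<lambda>x. g \<otimes>\<^bsub>H\<^esub> x) ` A" by (auto simp: l_coset_def)
    moreover have "inj_on (\<lambda>x. g \<otimes>\<^bsub>H\<^esub> x) A" using that by (auto simp: inj_on_def subset_iff)
    ultimately show ?thesis by (simp add: \<mu>_def card_image)
  qed
  ultimately show ?thesis
    unfolding amenable_def using pos by (intro exI[of _ \<mu>]) (simp add: \<mu>_def)
qed

lemma residually_finite_imp_initially_subamenable:
  assumes "residually_finite TYPE('h) G"
  shows "initially_subamenable TYPE('h) G"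
  unfolding initially_subamenable_def
proof (intro allI impI)
  fix E assume E: "finite E" "E \<subseteq> carrier G"
  then obtain H :: "'h monoid" and \<phi> where H: "group H" "finite (carrier H)"
    "\<phi> \<in> hom G H" "inj_on \<phi> E"
    using assms unfolding residually_finite_def by blast
  moreover have "\<phi> \<in> E \<rightarrow> carrier H" "\<forall>g\<in>E. \<forall>h\<in>E. \<phi> (g \<otimes>\<^bsub>G\<^esub> h) = \<phi> g \<otimes>\<^bsub>H\<^esub> \<phi> h"
    using H(3) E(2) by (auto simp: hom_def)
  ultimately show "\<exists>(H :: 'h monoid) \<phi>. group H \<and> amenable H \<and> \<phi> \<in> E \<rightarrow> carrier H \<and> inj_on \<phi> E \<and>
       (\<forall>g\<in>E. \<forall>h\<in>E. g \<otimes>\<^bsub>G\<^esub> h \<in> E \<longrightarrow> \<phi> (g \<otimes>\<^bsub>G\<^esub> h) = \<phi> g \<otimes>\<^bsub>H\<^esub> \<phi> h)"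
    using finite_group_amenable[OF H(1,2)] by blast
qed


section \<open>Matrices with infinite index sets\<close>

text \<open>Summing over the joint support lets one definition serve both row-finite matrices on
  arbitrary vectors and arbitrary matrices on finitely supported ones. Should the joint support be
  infinite, the value is 0 by convention.\<close>

definition mat_app :: "('p \<Rightarrow> 'q \<Rightarrow> 'k::field) \<Rightarrow> ('q \<Rightarrow> 'k) \<Rightarrow> 'p \<Rightarrow> 'k" where
  "mat_app K f p = (\<Sum>q | K p q \<noteq> 0 \<and> f q \<noteq> 0. K p q * f q)"

lemma mat_app_eq:
  assumes "finite T" "\<And>q. K p q \<noteq> 0 \<Longrightarrow> f q \<noteq> 0 \<Longrightarrow> q \<in> T"
  shows "mat_app K f p = (\<Sum>q\<in>T. K p q * f q)"
  unfolding mat_app_def using assms by (intro sum.mono_neutral_left) auto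

definition finsupp :: "'i set \<Rightarrow> ('i \<Rightarrow> 'k::zero) \<Rightarrow> bool" where
  "finsupp I f \<longleftrightarrow> finite {q. f q \<noteq> 0} \<and> {q. f q \<noteq> 0} \<subseteq> I"

lemma mat_app_sum:
  assumes "finite P" "\<And>o'. o' \<in> P \<Longrightarrow> finite {q. h o' q \<noteq> 0}"
  shows "mat_app K (\<lambda>x. \<Sum>o'\<in>P. c o' * h o' x) p = (\<Sum>o'\<in>P. c o' * mat_app K (h o') p)"
proof -
  let ?T = "\<Union>o'\<in>P. {q. h o' q \<noteq> 0}"
  have fin: "finite ?T" using assms by blast
  have "mat_app K (\<lambda>x. \<Sum>o'\<in>P. c o' * h o' x) p = (\<Sum>q\<in>?T. K p q * (\<Sum>o'\<in>P. c o' * h o' q))"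
  proof (rule mat_app_eq[OF fin])
    fix q assume "(\<Sum>o'\<in>P. c o' * h o' q) \<noteq> 0"
    then show "q \<in> ?T" by (auto elim!: sum.not_neutral_contains_not_neutral)
  qed
  also have "\<dots> = (\<Sum>o'\<in>P. \<Sum>q\<in>?T. c o' * (K p q * h o' q))"
    by (subst sum.swap) (simp add: sum_distrib_left mult_ac)
  also have "\<dots> = (\<Sum>o'\<in>P. c o' * mat_app K (h o') p)"
  proof (intro sum.cong refl)
    fix o' assume "o' \<in> P"
    then have "mat_app K (h o') p = (\<Sum>q\<in>?T. K p q * h o' q)"
      by (intro mat_app_eq[OF fin]) auto
    then show "(\<Sum>q\<in>?T. c o' * (K p q * h o' q)) = c o' * mat_app K (h o') p"
      by (simp add: sum_distrib_left)
  qed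
  finally show ?thesis .
qed

text \<open>The images under \<open>C\<close> of \<open>f\<close> and of the preimages under \<open>K\<close> of the unit vectors in \<open>Q\<close>
  all lie in the \<open>card Q\<close>-dimensional coordinate space of \<open>Q\<close>, so they are dependent.\<close>
lemma row_perturbation_injective:
  fixes K C :: "'i \<Rightarrow> 'i \<Rightarrow> 'k::field"
  assumes Q: "finite Q" and KC: "\<And>p q. p \<notin> Q \<Longrightarrow> K p q = C p q"
    and inj: "\<And>f. finsupp I f \<Longrightarrow> (\<And>p. mat_app C f p = 0) \<Longrightarrow> f = (\<lambda>_. 0)"
    and surj: "\<And>q. q \<in> Q \<Longrightarrow> \<exists>r. finsupp I r \<and> (\<forall>p. mat_app K r p = (if p = q then 1 else 0))"
    and f: "finsupp I f" "\<And>p. mat_app K f p = 0"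
  shows "f = (\<lambda>_. 0)"
proof -
  have "\<exists>r. \<forall>q\<in>Q. finsupp I (r q) \<and> (\<forall>p. mat_app K (r q) p = (if p = q then 1 else 0))"
    using surj by (intro bchoice) blast
  then obtain r where r: "\<And>q. q \<in> Q \<Longrightarrow> finsupp I (r q)"
    "\<And>q p. q \<in> Q \<Longrightarrow> mat_app K (r q) p = (if p = q then 1 else 0)" by blast
  define P where "P = insert None (Some ` Q)"
  define h where "h o' = (case o' of None \<Rightarrow> f | Some q \<Rightarrow> r q)" for o'
  have h: "finsupp I (h o')" if "o' \<in> P" for o' using that f r by (auto simp: h_def P_def)
  have finP: "finite P" using Q by (simp add: P_def)
  have "card Q < card P" using Q by (simp add: P_def card_image)
  then obtain c where c: "\<exists>o'\<in>P. c o' \<noteq> 0" "\<forall>p\<in>Q. (\<Sum>o'\<in>P. c o' * mat_app C (h o') p) = 0"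
    using homogeneous_system_nontrivial[OF Q finP, of "\<lambda>o'. mat_app C (h o')"] by blast
  define u where "u x = (\<Sum>o'\<in>P. c o' * h o' x)" for x
  have app_u: "mat_app A u p = (\<Sum>o'\<in>P. c o' * mat_app A (h o') p)" for A :: "'i \<Rightarrow> 'i \<Rightarrow> 'k" and p
    unfolding u_def using h by (intro mat_app_sum[OF finP]) (auto simp: finsupp_def)
  have "finsupp I u"
  proof -
    have "{q. u q \<noteq> 0} \<subseteq> (\<Union>o'\<in>P. {q. h o' q \<noteq> 0})"
      by (auto simp: u_def elim!: sum.not_neutral_contains_not_neutral)
    moreover have "finite (\<Union>o'\<in>P. {q. h o' q \<noteq> 0})" "(\<Union>o'\<in>P. {q. h o' q \<noteq> 0}) \<subseteq> I"
      using finP h by (auto simp: finsupp_def)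
    ultimately show ?thesis unfolding finsupp_def by (meson finite_subset subset_trans)
  qed
  moreover have "mat_app C u p = 0" for p
  proof (cases "p \<in> Q")
    case True
    then show ?thesis using c(2) by (simp add: app_u)
  next
    case False
    have "mat_app C (h o') p = 0" if "o' \<in> P" for o'
    proof -
      have "mat_app C (h o') p = mat_app K (h o') p"
        using KC[OF False] by (simp add: mat_app_def)
      also have "\<dots> = 0" using that False f(2) r(2) by (auto simp: P_def h_def)
      finally show ?thesis .
    qed
    then show ?thesis by (simp add: app_u)
  qed
  ultimately have u0: "u = (\<lambda>_. 0)" by (rule inj)
  \<comment> \<open>Since \<open>u = 0\<close>, applying \<open>K\<close> to it reads off the
    coefficient of each \<open>r q\<close>; only that of \<open>f\<close> can then be
    nonzero.\<close>
  have c_Some: "c (Some q) = 0" if "q \<in> Q" for q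
  proof -
    have "0 = mat_app K u q" by (simp add: u0 mat_app_def)
    also have "\<dots> = c None * mat_app K f q + (\<Sum>x\<in>Q. c (Some x) * mat_app K (r x) q)"
      using Q by (simp add: app_u P_def h_def sum.reindex)
    also have "(\<Sum>x\<in>Q. c (Some x) * mat_app K (r x) q) = (\<Sum>x\<in>Q. if q = x then c (Some x) else 0)"
      using r(2) by (intro sum.cong) auto
    finally show ?thesis using Q that f(2) by (simp add: sum.delta')
  qed
  then have "c None \<noteq> 0" using c(1) by (auto simp: P_def)
  moreover have "u x = c None * f x" for x
    using Q c_Some by (simp add: u_def P_def h_def sum.reindex)
  ultimately show ?thesis using u0 by (auto simp: fun_eq_iff)
qed

section \<open>Duality between finitely supported and arbitrary vectors\<close>

text \<open>As \<open>v\<close> is outside the span of the rows, some linear functional is 0 on the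
  rows and 1 at \<open>v\<close>; on finitely supported vectors it is the pairing with the vector
  \<open>y\<close> of its values at unit vectors. The matrix \<open>\<lambda>_::unit. v\<close> has
  \<open>v\<close> as its only row, so applying it to \<open>y\<close> is this pairing.\<close>

lemma separating_vector:
  fixes r :: "'p \<Rightarrow> 'i \<Rightarrow> 'k::field" and v :: "'i \<Rightarrow> 'k"
  assumes r: "\<And>p. p \<in> P \<Longrightarrow> finite {q. r p q \<noteq> 0}" and v: "finite {q. v q \<noteq> 0}"
    and indep: "\<And>c P0. finite P0 \<Longrightarrow> P0 \<subseteq> P \<Longrightarrow> \<exists>x. v x \<noteq> (\<Sum>p\<in>P0. c p * r p x)"
  shows "\<exists>y. (\<forall>p\<in>P. mat_app r y p = 0) \<and> mat_app (\<lambda>_::unit. v) y () = 1"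
proof -
  define sc :: "'k \<Rightarrow> ('i \<Rightarrow> 'k) \<Rightarrow> 'i \<Rightarrow> 'k" where "sc c f = (\<lambda>x. c * f x)" for c f
  interpret vector_space_pair sc "(*) :: 'k \<Rightarrow> 'k \<Rightarrow> 'k"
    by unfold_locales (auto simp: sc_def fun_eq_iff algebra_simps)
  have sum_app: "(\<Sum>a\<in>A. F a) x = (\<Sum>a\<in>A. F a x)" for A and F :: "'z \<Rightarrow> 'i \<Rightarrow> 'k" and x
    by (induction A rule: infinite_finite_induct) auto
  have "v \<notin> vs1.span (r ` P)"
  proof
    assume "v \<in> vs1.span (r ` P)"
    then obtain t k where t: "finite t" "t \<subseteq> r ` P" "v = (\<Sum>a\<in>t. sc (k a) a)"
      by (auto simp: vs1.span_explicit)
    obtain P0 where P0: "P0 \<subseteq> P" "inj_on r P0" "t = r ` P0"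
      using t(2) by (metis subset_image_inj)
    then have "finite P0" using t(1) finite_image_iff by blast
    moreover have "v x = (\<Sum>p\<in>P0. k (r p) * r p x)" for x
      unfolding t(3) sum_app P0(3) using P0(2) by (simp add: sum.reindex sc_def)
    ultimately show False using indep[of P0 "\<lambda>p. k (r p)"] P0(1) by auto
  qed
  \<comment> \<open>The functional will be prescribed on a basis \<open>A\<close> of the row space
    together with \<open>v\<close>.\<close>
  moreover obtain A where A: "A \<subseteq> r ` P" "vs1.independent A" "r ` P \<subseteq> vs1.span A"
    using vs1.maximal_independent_subset[of "r ` P"] by blast
  ultimately have vA: "v \<notin> vs1.span A" using vs1.span_mono[OF A(1)] by blast
  then have "vs1.independent (insert v A)" using A(2) by (rule vs1.independent_insertI)
  from linear_independent_extend[OF this, of "\<lambda>x. if x = v then 1 else 0"]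
  obtain g where g: "Vector_Spaces.linear sc (*) g" "\<And>x. x \<in> insert v A \<Longrightarrow> g x = (if x = v then 1 else 0)" by blast
  have "v \<notin> A" using vA vs1.span_base by blast
  then have gA: "g x = 0" if "x \<in> A" for x using g(2)[of x] that by auto
  have g0: "g (r p) = 0" if "p \<in> P" for p
    by (rule linear_eq_0_on_span[OF g(1) gA subsetD[OF A(3) imageI[OF that]]])
  define y where "y q = g (\<lambda>x. if x = q then 1 else 0)" for q
  have g_eq: "g u = (\<Sum>q | u q \<noteq> 0. u q * y q)" if "finite {q. u q \<noteq> 0}" for u
  proof -
    have u_eq: "u x = (\<Sum>q | u q \<noteq> 0. u q * (if x = q then 1 else 0))" for x
      using that by (simp add: if_distrib cong: if_cong)
    have "u = (\<Sum>q | u q \<noteq> 0. sc (u q) (\<lambda>x. if x = q then 1 else 0))"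
      by (rule ext) (unfold sum_app sc_def, rule u_eq)
    then have "g u = g (\<Sum>q | u q \<noteq> 0. sc (u q) (\<lambda>x. if x = q then 1 else 0))"
      by (rule arg_cong)
    also have "\<dots> = (\<Sum>q | u q \<noteq> 0. u q * y q)"
      by (simp only: linear_sum[OF g(1)] linear_scale[OF g(1)] y_def)
    finally show ?thesis .
  qed
  have "mat_app r y p = 0" if "p \<in> P" for p
    using mat_app_eq[OF r[OF that], of r p y] g_eq[OF r[OF that]] g0[OF that] by simp
  moreover have "mat_app (\<lambda>_::unit. v) y () = 1"
    using mat_app_eq[OF v, of "\<lambda>_. v" "()" y] g_eq[OF v] g(2)[of v] by simp
  ultimately show ?thesis by blast
qed

text \<open>If the unit vector at \<open>q0\<close> were no combination of rows, some
  \<open>y\<close> orthogonal to all rows would have \<open>y q0 = 1\<close>. Nothing bounds the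
  support of \<open>y\<close>, so it is injectivity on all vectors that excludes it.\<close>

lemma transpose_surjective:
  fixes K :: "'i \<Rightarrow> 'i \<Rightarrow> 'k::field"
  assumes rows: "\<And>p. finite {q. K p q \<noteq> 0}" and supp: "\<And>p q. K p q \<noteq> 0 \<Longrightarrow> p \<in> I \<and> q \<in> I"
    and inj: "\<And>x. (\<And>p. mat_app K x p = 0) \<Longrightarrow> (\<And>q. q \<in> I \<Longrightarrow> x q = 0)"
    and q0: "q0 \<in> I"
  shows "\<exists>f. finsupp I f \<and> (\<forall>q. mat_app (\<lambda>q p. K p q) f q = (if q = q0 then 1 else 0))"
proof (rule ccontr)
  assume contr: "\<not> ?thesis"
  let ?v = "\<lambda>q. if q = q0 then 1 else (0::'k)"
  have indep: "\<exists>x. ?v x \<noteq> (\<Sum>p\<in>P0. c p * K p x)" if P0: "finite P0" "P0 \<subseteq> I" for c P0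
  proof (rule ccontr)
    assume "\<nexists>x. ?v x \<noteq> (\<Sum>p\<in>P0. c p * K p x)"
    then have eq: "(\<Sum>p\<in>P0. c p * K p x) = ?v x" for x by metis
    define f where "f p = (if p \<in> P0 then c p else 0)" for p
    have "finsupp I f" using P0 by (auto simp: finsupp_def f_def intro: finite_subset[OF _ P0(1)])
    moreover have "mat_app (\<lambda>q p. K p q) f q = ?v q" for q
    proof -
      have "mat_app (\<lambda>q p. K p q) f q = (\<Sum>p\<in>P0. K p q * f p)"
        using P0(1) by (intro mat_app_eq) (auto simp: f_def split: if_splits)
      also have "\<dots> = (\<Sum>p\<in>P0. c p * K p q)" by (simp add: f_def mult.commute)
      finally show ?thesis using eq by simp
    qed
    ultimately show False using contr by blast
  qed
  have "finite {q. ?v q \<noteq> 0}" by simp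
  have "\<exists>y. (\<forall>p\<in>I. mat_app K y p = 0) \<and> mat_app (\<lambda>_::unit. ?v) y () = 1"
    by (rule separating_vector[OF rows \<open>finite {q. ?v q \<noteq> 0}\<close>]) (rule indep)
  then obtain y where y: "\<forall>p\<in>I. mat_app K y p = 0" "mat_app (\<lambda>_::unit. ?v) y () = 1"
    by (elim exE conjE)
  have "mat_app K y p = 0" for p
    using y(1) supp by (cases "p \<in> I") (auto simp: mat_app_def intro!: sum.neutral)
  then have "y q0 = 0" using inj q0 by blast
  moreover have "mat_app (\<lambda>_::unit. ?v) y () = y q0"
    by (subst mat_app_eq[of "{q0}"]) (auto split: if_splits)
  ultimately show False using y(2) by simp
qed

text \<open>The system is made homogeneous by adjoining the right-hand side as a column
  \<open>None\<close>. It can be unsolvable only if the unit vector at \<open>None\<close> is a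
  combination of the rows; the coefficients would form a finitely supported kernel vector of the
  transpose and hence vanish.\<close>

lemma surjective_of_transpose_injective:
  fixes K :: "'i \<Rightarrow> 'i \<Rightarrow> 'k::field"
  assumes rows: "\<And>p. finite {q. K p q \<noteq> 0}"
    and inj: "\<And>f. finsupp I f \<Longrightarrow> (\<And>q. mat_app (\<lambda>q p. K p q) f q = 0) \<Longrightarrow> f = (\<lambda>_. 0)"
  shows "\<exists>x. \<forall>p\<in>I. mat_app K x p = t p"
proof -
  define r where "r p = (\<lambda>o'. case o' of None \<Rightarrow> t p | Some q \<Rightarrow> K p q)" for p
  define v :: "'i option \<Rightarrow> 'k" where "v o' = (if o' = None then 1 else 0)" for o'
  have r: "{q. r p q \<noteq> 0} \<subseteq> insert None (Some ` {q. K p q \<noteq> 0})" for p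
  proof
    fix x assume "x \<in> {q. r p q \<noteq> 0}"
    then show "x \<in> insert None (Some ` {q. K p q \<noteq> 0})" by (cases x) (auto simp: r_def)
  qed
  have finr: "finite {q. r p q \<noteq> 0}" for p
    by (rule finite_subset[OF r]) (simp add: rows)
  have "\<exists>x. v x \<noteq> (\<Sum>p\<in>P0. c p * r p x)" if P0: "finite P0" "P0 \<subseteq> I" for c P0
  proof (rule ccontr)
    assume "\<nexists>x. v x \<noteq> (\<Sum>p\<in>P0. c p * r p x)"
    then have eq: "(\<Sum>p\<in>P0. c p * r p x) = v x" for x by metis
    define f where "f p = (if p \<in> P0 then c p else 0)" for p
    have "finsupp I f" using P0 by (auto simp: finsupp_def f_def intro: finite_subset[OF _ P0(1)])
    moreover have "mat_app (\<lambda>q p. K p q) f q = 0" for q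
    proof -
      have "mat_app (\<lambda>q p. K p q) f q = (\<Sum>p\<in>P0. K p q * f p)"
        using P0(1) by (intro mat_app_eq) (auto simp: f_def split: if_splits)
      also have "\<dots> = (\<Sum>p\<in>P0. c p * r p (Some q))" by (simp add: f_def r_def mult.commute)
      finally show ?thesis by (simp add: eq v_def)
    qed
    ultimately have f0: "f = (\<lambda>_. 0)" by (rule inj)
    have "c p = 0" if "p \<in> P0" for p
    proof -
      have "f p = 0" using f0 by simp
      then show ?thesis using that by (simp add: f_def)
    qed
    then show False using eq[of None] by (simp add: v_def)
  qed
  moreover have "finite {q. v q \<noteq> 0}"
    by (rule finite_subset[of _ "{None}"]) (auto simp: v_def split: if_splits)
  ultimately obtain y where y: "\<forall>p\<in>I. mat_app r y p = 0" "mat_app (\<lambda>_::unit. v) y () = 1"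
    using separating_vector[of I r v] finr by blast
  have "y None = mat_app (\<lambda>_::unit. v) y ()"
    by (subst mat_app_eq[of "{None}"]) (auto simp: v_def split: if_splits)
  then have yN: "y None = 1" using y(2) by simp
  \<comment> \<open>With \<open>y None = 1\<close>, orthogonality to row \<open>p\<close> says that
    \<open>t p\<close> and the sum of the \<open>K p q * y (Some q)\<close> are opposite, whence the
    sign.\<close>
  have "mat_app K (\<lambda>q. - y (Some q)) p = t p" if "p \<in> I" for p
  proof -
    have "mat_app K (\<lambda>q. - y (Some q)) p = (\<Sum>q | K p q \<noteq> 0. K p q * - y (Some q))"
      using rows by (intro mat_app_eq) auto
    moreover have "mat_app r y p = (\<Sum>o'\<in>insert None (Some ` {q. K p q \<noteq> 0}). r p o' * y o')"
      using rows r by (intro mat_app_eq) auto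
    moreover have "\<dots> = t p * y None + (\<Sum>q | K p q \<noteq> 0. K p q * y (Some q))"
      using rows by (simp add: sum.reindex r_def)
    ultimately show ?thesis using y(1) that yN by (simp add: sum_negf add_eq_0_iff)
  qed
  then show ?thesis by blast
qed


section \<open>Perturbations of convolution matrices\<close>

definition conv_mat ::
  "('g, 'c) monoid_scheme \<Rightarrow> 'g set \<Rightarrow> 'b set \<Rightarrow> ('g \<Rightarrow> 'b \<Rightarrow> 'b \<Rightarrow> 'k::field) \<Rightarrow> 'g \<times> 'b \<Rightarrow> 'g \<times> 'b \<Rightarrow> 'k"
  where "conv_mat G U B a p q =
    (if p \<in> carrier G \<times> B \<and> q \<in> carrier G \<times> B \<and> inv\<^bsub>G\<^esub> (fst q) \<otimes>\<^bsub>G\<^esub> fst p \<in> U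
     then a (inv\<^bsub>G\<^esub> (fst q) \<otimes>\<^bsub>G\<^esub> fst p) (snd p) (snd q) else 0)"

lemma (in group) mat_app_conv_mat:
  assumes U: "finite U" "U \<subseteq> carrier G" and B: "finite B" and g: "g \<in> carrier G" and i: "i \<in> B"
  shows "mat_app (conv_mat G U B a) f (g, i) = group_conv G U B a f g i"
proof -
  let ?h = "\<lambda>(u, l). (g \<otimes> inv u, l)"
  have inj: "inj_on ?h (U \<times> B)"
    using U(2) g by (auto simp: inj_on_def) (metis inv_closed inv_inv Units_eq Units_l_cancel subsetD)
  have "mat_app (conv_mat G U B a) f (g, i) = (\<Sum>q\<in>?h ` (U \<times> B). conv_mat G U B a (g, i) q * f q)"
  proof (rule mat_app_eq)
    show "finite (?h ` (U \<times> B))" using U B by simp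
    fix q assume "conv_mat G U B a (g, i) q \<noteq> 0"
    then have q: "fst q \<in> carrier G" "snd q \<in> B" "inv (fst q) \<otimes> g \<in> U"
      by (auto simp: conv_mat_def split: if_splits)
    have "g \<otimes> inv (inv (fst q) \<otimes> g) = fst q"
      using q g by (simp add: inv_mult_group m_assoc[symmetric])
    then show "q \<in> ?h ` (U \<times> B)" using q by (intro image_eqI[of _ _ "(inv (fst q) \<otimes> g, snd q)"]) auto
  qed
  also have "\<dots> = (\<Sum>(u, l)\<in>U \<times> B. conv_mat G U B a (g, i) (g \<otimes> inv u, l) * f (g \<otimes> inv u, l))"
    by (subst sum.reindex[OF inj]) (simp add: case_prod_unfold)
  also have "\<dots> = (\<Sum>(u, l)\<in>U \<times> B. a u i l * f (g \<otimes> inv u, l))"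
  proof (intro sum.cong refl, clarify)
    fix u l assume ul: "u \<in> U" "l \<in> B"
    then have u: "u \<in> carrier G" using U by blast
    then have "inv (g \<otimes> inv u) \<otimes> g = u" using g by (simp add: inv_mult_group m_assoc)
    then show "conv_mat G U B a (g, i) (g \<otimes> inv u, l) * f (g \<otimes> inv u, l) = a u i l * f (g \<otimes> inv u, l)"
      using u ul g i by (simp add: conv_mat_def)
  qed
  finally show ?thesis by (simp add: group_conv_def sum.cartesian_product)
qed

text \<open>By translation invariance the preimages of the unit vectors at \<open>\<one>\<close>
  carry all of surjectivity. Together with \<open>z\<close> they involve finitely many group
  elements, collected in \<open>W\<close>.\<close>

lemma conv_mat_surjective_imp_injective:
  fixes G :: "('g, 'c) monoid_scheme" (structure) and a :: "'g \<Rightarrow> 'b \<Rightarrow> 'b \<Rightarrow> 'k::field"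
  assumes G: "group G" "initially_subamenable TYPE('h) G" and U: "finite U" "U \<subseteq> carrier G"
    and B: "finite B"
    and surj: "\<And>q. q \<in> carrier G \<times> B \<Longrightarrow> \<exists>f. finsupp (carrier G \<times> B) f \<and>
      (\<forall>p. mat_app (conv_mat G U B a) f p = (if p = q then 1 else 0))"
    and z: "finsupp (carrier G \<times> B) z" "\<And>p. mat_app (conv_mat G U B a) z p = 0"
  shows "z = (\<lambda>_. 0)"
proof -
  interpret group G by fact
  have "\<exists>b. \<forall>j\<in>B. finsupp (carrier G \<times> B) (b j) \<and>
      (\<forall>p. mat_app (conv_mat G U B a) (b j) p = (if p = (\<one>, j) then 1 else 0))"
    by (intro bchoice ballI surj) simp
  then obtain b where b: "\<And>j. j \<in> B \<Longrightarrow> finsupp (carrier G \<times> B) (b j)"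
    "\<And>j p. j \<in> B \<Longrightarrow> mat_app (conv_mat G U B a) (b j) p = (if p = (\<one>, j) then 1 else 0)"
    by blast
  define W where "W = fst ` ((\<Union>j\<in>B. {q. b j q \<noteq> 0}) \<union> {q. z q \<noteq> 0})"
  have W: "finite W" "W \<subseteq> carrier G"
    using B b(1) z(1) by (force simp: W_def finsupp_def)+
  have "z (g, l) = 0" if "g \<in> carrier G" "l \<in> B" for g l
  proof (rule group_conv_kernel_trivial[OF G U B W _ _ _ _ that])
    show "h \<in> W" if "j \<in> B" "b j (h, l) \<noteq> 0" for j h l using that by (force simp: W_def)
    show "h \<in> W" if "z (h, l) \<noteq> 0" for h l using that by (force simp: W_def)
    show "group_conv G U B a (b j) g i = (if g = \<one> \<and> i = j then 1 else 0)"
      if "j \<in> B" "g \<in> carrier G" "i \<in> B" for j g i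
      using b(2)[OF that(1), of "(g, i)"] unfolding mat_app_conv_mat[OF U B that(2,3)] by simp
    show "group_conv G U B a z g i = 0" if "g \<in> carrier G" "i \<in> B" for g i
      using z(2)[of "(g, i)"] unfolding mat_app_conv_mat[OF U B that] .
  qed
  then have "z q = 0" for q using z(1) by (cases q) (auto simp: finsupp_def)
  then show ?thesis by (rule ext)
qed

text \<open>Surjectivity of the unperturbed matrix is demanded for infinite \<open>carrier G\<close>
  only: over a finite group the orbit is closed and may miss the constant configuration. With
  finitely many indices every row may count as perturbed, and any injective matrix can serve for
  comparison.\<close>

lemma perturbed_conv_mat_surjective_imp_injective:
  fixes G :: "('g, 'c) monoid_scheme" (structure) and a :: "'g \<Rightarrow> 'b \<Rightarrow> 'b \<Rightarrow> 'k::field"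
  assumes G: "group G" "initially_subamenable TYPE('h) G" and U: "finite U" "U \<subseteq> carrier G"
    and B: "finite B"
    and Q: "finite Q" "Q \<subseteq> carrier G \<times> B" and K: "\<And>p q. p \<notin> Q \<Longrightarrow> K p q = conv_mat G U B a p q"
    and K_supp: "\<And>p q. K p q \<noteq> 0 \<Longrightarrow> p \<in> carrier G \<times> B"
    and K_surj: "\<And>q. q \<in> carrier G \<times> B \<Longrightarrow> \<exists>f. finsupp (carrier G \<times> B) f \<and>
      (\<forall>p. mat_app K f p = (if p = q then 1 else 0))"
    and C_surj: "\<And>q. infinite (carrier G) \<Longrightarrow> q \<in> carrier G \<times> B \<Longrightarrow> \<exists>f. finsupp (carrier G \<times> B) f \<and>
      (\<forall>p. mat_app (conv_mat G U B a) f p = (if p = q then 1 else 0))"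
    and z: "finsupp (carrier G \<times> B) z" "\<And>p. mat_app K z p = 0"
  shows "z = (\<lambda>_. 0)"
proof (cases "finite (carrier G)")
  case True
  define D :: "'g \<times> 'b \<Rightarrow> 'g \<times> 'b \<Rightarrow> 'k" where "D p q = (if p = q \<and> p \<in> carrier G \<times> B then 1 else 0)" for p q
  show ?thesis
  proof (rule row_perturbation_injective[where K = K and C = D and Q = "carrier G \<times> B", OF _ _ _ K_surj z])
    show "finite (carrier G \<times> B)" using True B by simp
    show "K p q = D p q" if "p \<notin> carrier G \<times> B" for p q
      using K_supp[of p q] that by (auto simp: D_def)
    show "f = (\<lambda>_. 0)" if f: "finsupp (carrier G \<times> B) f" "\<And>p. mat_app D f p = 0" for f
    proof
      fix p
      have "mat_app D f p = (\<Sum>q\<in>{p}. D p q * f q)"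
        by (rule mat_app_eq) (auto simp: D_def split: if_splits)
      then have "D p p * f p = 0" using f(2) by simp
      then show "f p = 0" using f(1) by (auto simp: D_def finsupp_def split: if_splits)
    qed
  qed
next
  case False
  show ?thesis
  proof (rule row_perturbation_injective[where K = K and C = "conv_mat G U B a", OF Q(1) K _ _ z])
    show "f = (\<lambda>_. 0)" if "finsupp (carrier G \<times> B) f" "\<And>p. mat_app (conv_mat G U B a) f p = 0" for f
      using conv_mat_surjective_imp_injective[OF G U B C_surj[OF False] that] .
    show "\<exists>r. finsupp (carrier G \<times> B) r \<and> (\<forall>p. mat_app K r p = (if p = q then 1 else 0))"
      if "q \<in> Q" for q using K_surj that Q(2) by blast
  qed
qed

section \<open>Matrices of cellular automata\<close>

text \<open>A cell reads the cells \<open>fst p \<otimes> m\<close>, whereas convolution reads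
  \<open>fst p \<otimes> inv u\<close>. Constant coefficients therefore give a convolution over the
  inverses of \<open>M\<close>, and their transpose a convolution over \<open>M\<close>
  itself.\<close>

definition nuca_mat ::
  "('g, 'c) monoid_scheme \<Rightarrow> 'g set \<Rightarrow> 'b set \<Rightarrow> ('g \<Rightarrow> 'g \<Rightarrow> 'b \<Rightarrow> 'b \<Rightarrow> 'k::field) \<Rightarrow> 'g \<times> 'b \<Rightarrow> 'g \<times> 'b \<Rightarrow> 'k"
  where "nuca_mat G M B \<alpha> p q =
    (if p \<in> carrier G \<times> B \<and> q \<in> carrier G \<times> B \<and> inv\<^bsub>G\<^esub> (fst p) \<otimes>\<^bsub>G\<^esub> fst q \<in> M
     then \<alpha> (fst p) (inv\<^bsub>G\<^esub> (fst p) \<otimes>\<^bsub>G\<^esub> fst q) (snd p) (snd q) else 0)"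

context group
begin

lemma nuca_mat_row:
  "{q. nuca_mat G M B \<alpha> p q \<noteq> 0} \<subseteq> (\<lambda>(m, l). (fst p \<otimes> m, l)) ` (M \<times> B)"
proof
  fix q assume "q \<in> {q. nuca_mat G M B \<alpha> p q \<noteq> 0}"
  then have q: "fst p \<in> carrier G" "fst q \<in> carrier G" "snd q \<in> B" "inv (fst p) \<otimes> fst q \<in> M"
    by (auto simp: nuca_mat_def split: if_splits)
  have "fst p \<otimes> (inv (fst p) \<otimes> fst q) = fst q" using q by (simp add: m_assoc[symmetric])
  then show "q \<in> (\<lambda>(m, l). (fst p \<otimes> m, l)) ` (M \<times> B)"
    using q by (intro image_eqI[of _ _ "(inv (fst p) \<otimes> fst q, snd q)"]) auto
qed

lemma finite_nuca_mat_row: "finite M \<Longrightarrow> finite B \<Longrightarrow> finite {q. nuca_mat G M B \<alpha> p q \<noteq> 0}"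
  by (rule finite_subset[OF nuca_mat_row]) simp

lemma nuca_mat_const_eq_conv_mat:
  assumes "M \<subseteq> carrier G"
  shows "nuca_mat G M B (\<lambda>_. \<gamma>) = conv_mat G (m_inv G ` M) B (\<lambda>u. \<gamma> (inv u))"
proof (intro ext)
  fix p q
  show "nuca_mat G M B (\<lambda>_. \<gamma>) p q = conv_mat G (m_inv G ` M) B (\<lambda>u. \<gamma> (inv u)) p q"
  proof (cases "p \<in> carrier G \<times> B \<and> q \<in> carrier G \<times> B")
    case True
    then have pq: "fst p \<in> carrier G" "fst q \<in> carrier G" by auto
    then have eq: "inv (inv (fst q) \<otimes> fst p) = inv (fst p) \<otimes> fst q"
      by (simp add: inv_mult_group)
    moreover have "inv (fst q) \<otimes> fst p \<in> m_inv G ` M \<longleftrightarrow> inv (fst p) \<otimes> fst q \<in> M"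
    proof
      assume "inv (fst q) \<otimes> fst p \<in> m_inv G ` M"
      then obtain m where "m \<in> M" "inv (fst q) \<otimes> fst p = inv m" by blast
      then show "inv (fst p) \<otimes> fst q \<in> M" using eq assms by (metis inv_inv subsetD)
    next
      assume "inv (fst p) \<otimes> fst q \<in> M"
      moreover have "inv (fst q) \<otimes> fst p = inv (inv (fst p) \<otimes> fst q)"
        using pq by (simp add: inv_mult_group)
      ultimately show "inv (fst q) \<otimes> fst p \<in> m_inv G ` M" by blast
    qed
    ultimately show ?thesis by (simp add: nuca_mat_def conv_mat_def)
  next
    case False
    then show ?thesis by (auto simp: nuca_mat_def conv_mat_def)
  qed
qed

lemma transpose_nuca_mat_const_eq_conv_mat:
  "(\<lambda>q p. nuca_mat G M B (\<lambda>_. \<gamma>) p q) = conv_mat G M B (\<lambda>u i l. \<gamma> u l i)"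
  by (auto simp: nuca_mat_def conv_mat_def fun_eq_iff)

end

lemma nuca_mat_surjective_imp_injective:
  fixes G :: "('g, 'c) monoid_scheme" (structure) and \<alpha> :: "'g \<Rightarrow> 'g \<Rightarrow> 'b \<Rightarrow> 'b \<Rightarrow> 'k::field"
  assumes G: "group G" "initially_subamenable TYPE('h) G" and M: "finite M" "M \<subseteq> carrier G"
    and B: "finite B" and F: "finite F" "F \<subseteq> carrier G"
    and \<alpha>: "\<And>g. g \<in> carrier G - F \<Longrightarrow> \<alpha> g = \<gamma>"
    and K_surj: "\<And>q. q \<in> carrier G \<times> B \<Longrightarrow> \<exists>f. finsupp (carrier G \<times> B) f \<and>
      (\<forall>p. mat_app (nuca_mat G M B \<alpha>) f p = (if p = q then 1 else 0))"
    and C_surj: "\<And>q. infinite (carrier G) \<Longrightarrow> q \<in> carrier G \<times> B \<Longrightarrow> \<exists>f. finsupp (carrier G \<times> B) f \<and>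
      (\<forall>p. mat_app (nuca_mat G M B (\<lambda>_. \<gamma>)) f p = (if p = q then 1 else 0))"
    and z: "finsupp (carrier G \<times> B) z" "\<And>p. mat_app (nuca_mat G M B \<alpha>) z p = 0"
  shows "z = (\<lambda>_. 0)"
proof -
  interpret group G by fact
  let ?U = "m_inv G ` M" and ?a = "\<lambda>u. \<gamma> (inv u)"
  note C = nuca_mat_const_eq_conv_mat[OF M(2), of B \<gamma>]
  show ?thesis
  proof (rule perturbed_conv_mat_surjective_imp_injective[OF G _ _ B _ _ _ _ K_surj _ z,
        where U = ?U and a = ?a and Q = "F \<times> B"])
    show "finite ?U" "?U \<subseteq> carrier G" "finite (F \<times> B)" "F \<times> B \<subseteq> carrier G \<times> B"
      using M B F by auto
    show "nuca_mat G M B \<alpha> p q = conv_mat G ?U B ?a p q" if "p \<notin> F \<times> B" for p q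
    proof (cases "p \<in> carrier G \<times> B")
      case True
      then have "\<alpha> (fst p) = \<gamma>" using that by (intro \<alpha>) auto
      then show ?thesis unfolding C[symmetric] by (simp add: nuca_mat_def)
    next
      case False
      then show ?thesis unfolding C[symmetric] by (simp add: nuca_mat_def)
    qed
    show "p \<in> carrier G \<times> B" if "nuca_mat G M B \<alpha> p q \<noteq> 0" for p q
      using that by (simp add: nuca_mat_def split: if_splits)
    show "\<exists>f. finsupp (carrier G \<times> B) f \<and> (\<forall>p. mat_app (conv_mat G ?U B ?a) f p = (if p = q then 1 else 0))"
      if "infinite (carrier G)" "q \<in> carrier G \<times> B" for q
      using C_surj[OF that] unfolding C .
  qed
qed

text \<open>Injectivity makes the transpose surjective on finitely supported vectors,
  \<open>perturbed_conv_mat_surjective_imp_injective\<close> makes it injective there, and dualising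
  again solves every system for the matrix itself.\<close>

lemma nuca_mat_injective_imp_surjective:
  fixes G :: "('g, 'c) monoid_scheme" (structure) and \<alpha> :: "'g \<Rightarrow> 'g \<Rightarrow> 'b \<Rightarrow> 'b \<Rightarrow> 'k::field"
  assumes G: "group G" "initially_subamenable TYPE('h) G" and M: "finite M" "M \<subseteq> carrier G"
    and B: "finite B" and F: "finite F" "F \<subseteq> carrier G"
    and \<alpha>: "\<And>g. g \<in> carrier G - F \<Longrightarrow> \<alpha> g = \<gamma>"
    and K_inj: "\<And>x q. (\<And>p. mat_app (nuca_mat G M B \<alpha>) x p = 0) \<Longrightarrow> q \<in> carrier G \<times> B \<Longrightarrow> x q = 0"
    and C_inj: "\<And>x q. infinite (carrier G) \<Longrightarrow> (\<And>p. mat_app (nuca_mat G M B (\<lambda>_. \<gamma>)) x p = 0) \<Longrightarrow>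
      q \<in> carrier G \<times> B \<Longrightarrow> x q = 0"
  shows "\<exists>x. \<forall>p\<in>carrier G \<times> B. mat_app (nuca_mat G M B \<alpha>) x p = t p"
proof -
  interpret group G by fact
  let ?I = "carrier G \<times> B" and ?K = "nuca_mat G M B \<alpha>" and ?C = "nuca_mat G M B (\<lambda>_. \<gamma>)"
  let ?a = "\<lambda>u i l. \<gamma> u l i"
  note C = transpose_nuca_mat_const_eq_conv_mat[of M B \<gamma>]
  have supp: "p \<in> ?I \<and> q \<in> ?I" if "nuca_mat G M B \<beta> p q \<noteq> 0"
    for p q and \<beta> :: "'g \<Rightarrow> 'g \<Rightarrow> 'b \<Rightarrow> 'b \<Rightarrow> 'k"
    using that by (simp add: nuca_mat_def split: if_splits)
  \<comment> \<open>Exceptional rows become exceptional columns of the transpose. Since the row of a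
    cell \<open>g\<close> is supported over \<open>g M\<close>, these columns meet only the finitely
    many rows listed here.\<close>
  define Q where "Q = (\<lambda>(x, (m, l)). (fst x \<otimes> m, l)) ` ((F \<times> B) \<times> (M \<times> B))"
  show ?thesis
  proof (rule surjective_of_transpose_injective)
    show "finite {q. ?K p q \<noteq> 0}" for p by (rule finite_nuca_mat_row[OF M(1) B])
    fix f assume f: "finsupp ?I f" "\<And>q. mat_app (\<lambda>q p. ?K p q) f q = 0"
    show "f = (\<lambda>_. 0)"
    proof (rule perturbed_conv_mat_surjective_imp_injective[OF G M B _ _ _ _ _ _ f, where Q = Q and a = ?a])
      show "finite Q" "Q \<subseteq> ?I" using F M B by (auto simp: Q_def subset_iff)
      show "?K q p = conv_mat G M B ?a p q" if "p \<notin> Q" for p q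
      proof -
        have "?K q p = ?C q p"
        proof (cases "q \<in> F \<times> B")
          case False
          show ?thesis
          proof (cases "q \<in> ?I")
            case True
            then have "\<alpha> (fst q) = \<gamma>" using False by (intro \<alpha>) auto
            then show ?thesis by (simp add: nuca_mat_def)
          next
            case False
            then show ?thesis by (simp add: nuca_mat_def)
          qed
        next
          case True
          have "\<not> (p \<in> ?I \<and> inv (fst q) \<otimes> fst p \<in> M)"
          proof
            assume *: "p \<in> ?I \<and> inv (fst q) \<otimes> fst p \<in> M"
            then have "fst q \<otimes> (inv (fst q) \<otimes> fst p) = fst p"
              using True F by (auto simp: m_assoc[symmetric])
            then have "p \<in> Q" using * True unfolding Q_def
              by (intro image_eqI[of _ _ "(q, (inv (fst q) \<otimes> fst p, snd p))"]) auto
            then show False using that by simp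
          qed
          then show ?thesis by (auto simp: nuca_mat_def)
        qed
        then show ?thesis using fun_cong[OF fun_cong[OF C, of p], of q] by simp
      qed
      show "p \<in> ?I" if "?K q p \<noteq> 0" for p q using supp[OF that] by simp
      show "\<exists>f. finsupp ?I f \<and> (\<forall>q'. mat_app (\<lambda>q p. ?K p q) f q' = (if q' = q then 1 else 0))"
        if "q \<in> ?I" for q
      proof (rule transpose_surjective[where K = ?K and I = ?I])
          show "finite {q. ?K p q \<noteq> 0}" for p by (rule finite_nuca_mat_row[OF M(1) B])
          show "p \<in> ?I \<and> q \<in> ?I" if "?K p q \<noteq> 0" for p q by (rule supp[OF that])
          show "x r = 0" if "\<And>p. mat_app ?K x p = 0" "r \<in> ?I" for x r by (rule K_inj[OF that])
          show "q \<in> ?I" by fact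
        qed
      show "\<exists>f. finsupp ?I f \<and> (\<forall>q'. mat_app (conv_mat G M B ?a) f q' = (if q' = q then 1 else 0))"
        if inf: "infinite (carrier G)" and "q \<in> ?I" for q
        unfolding C[symmetric]
      proof (rule transpose_surjective[where K = ?C and I = ?I])
          show "finite {q. ?C p q \<noteq> 0}" for p by (rule finite_nuca_mat_row[OF M(1) B])
          show "p \<in> ?I \<and> q \<in> ?I" if "?C p q \<noteq> 0" for p q by (rule supp[OF that])
          show "x r = 0" if "\<And>p. mat_app ?C x p = 0" "r \<in> ?I" for x r by (rule C_inj[OF inf that])
          show "q \<in> ?I" by fact
        qed
    qed
  qed
qed


lemma (in group) mat_app_nuca_mat:
  assumes M: "finite M" "M \<subseteq> carrier G" and B: "finite B" and g: "g \<in> carrier G" and i: "i \<in> B"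
  shows "mat_app (nuca_mat G M B \<alpha>) f (g, i) = (\<Sum>(m, l)\<in>M \<times> B. \<alpha> g m i l * f (g \<otimes> m, l))"
proof -
  let ?h = "\<lambda>(m, l). (g \<otimes> m, l)"
  have inj: "inj_on ?h (M \<times> B)"
    using M(2) g by (auto simp: inj_on_def subset_iff)
  have "mat_app (nuca_mat G M B \<alpha>) f (g, i) = (\<Sum>q\<in>?h ` (M \<times> B). nuca_mat G M B \<alpha> (g, i) q * f q)"
  proof (rule mat_app_eq)
    show "finite (?h ` (M \<times> B))" using M B by simp
    show "q \<in> ?h ` (M \<times> B)" if "nuca_mat G M B \<alpha> (g, i) q \<noteq> 0" for q
      using nuca_mat_row[of M B \<alpha> "(g, i)"] that by auto
  qed
  also have "\<dots> = (\<Sum>(m, l)\<in>M \<times> B. nuca_mat G M B \<alpha> (g, i) (g \<otimes> m, l) * f (g \<otimes> m, l))"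
    by (subst sum.reindex[OF inj]) (simp add: case_prod_unfold)
  also have "\<dots> = (\<Sum>(m, l)\<in>M \<times> B. \<alpha> g m i l * f (g \<otimes> m, l))"
  proof (intro sum.cong refl, clarify)
    fix m l assume ml: "m \<in> M" "l \<in> B"
    then have m: "m \<in> carrier G" using M by blast
    then have "inv g \<otimes> (g \<otimes> m) = m" using g by (simp add: m_assoc[symmetric])
    then show "nuca_mat G M B \<alpha> (g, i) (g \<otimes> m, l) * f (g \<otimes> m, l) = \<alpha> g m i l * f (g \<otimes> m, l)"
      using m ml g i by (simp add: nuca_mat_def)
  qed
  finally show ?thesis .
qed

lemma mat_app_nuca_mat_outside: "p \<notin> carrier G \<times> B \<Longrightarrow> mat_app (nuca_mat G M B \<alpha>) f p = 0"
  by (simp add: mat_app_def nuca_mat_def)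

lemma nuca_mat_cong:
  "(\<And>g. g \<in> carrier G \<Longrightarrow> \<alpha> g = \<beta> g) \<Longrightarrow> nuca_mat G M B \<alpha> = nuca_mat G M B \<beta>"
  by (auto simp: nuca_mat_def fun_eq_iff)

section \<open>Linear NUCA in coordinates\<close>

context finite_dimensional_vector_space
begin

text \<open>Off \<open>carrier G \<times> Basis\<close> the passage to coordinates is not rigid:
  \<open>vec\<close> ignores the values there, and \<open>coords\<close> sets them to 0, as
  \<open>finsupp\<close> requires.\<close>

definition vec :: "('g, 'c) monoid_scheme \<Rightarrow> ('g \<times> 'b \<Rightarrow> 'a) \<Rightarrow> 'g \<Rightarrow> 'b" where
  "vec G f = (\<lambda>g\<in>carrier G. \<Sum>l\<in>Basis. scale (f (g, l)) l)"

definition coords :: "('g, 'c) monoid_scheme \<Rightarrow> ('g \<Rightarrow> 'b) \<Rightarrow> 'g \<times> 'b \<Rightarrow> 'a" where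
  "coords G x = (\<lambda>(g, l). if g \<in> carrier G \<and> l \<in> Basis then representation Basis (x g) l else 0)"

definition symbol :: "'g set \<Rightarrow> ('g \<Rightarrow> ('g \<Rightarrow> 'b) \<Rightarrow> 'b) \<Rightarrow> 'g \<Rightarrow> 'g \<Rightarrow> 'b \<Rightarrow> 'b \<Rightarrow> 'a" where
  "symbol M s g m i l = representation Basis (s g (\<lambda>h\<in>M. if h = m then l else 0)) i"

lemma vec_in_PiE: "vec G f \<in> carrier G \<rightarrow>\<^sub>E UNIV"
  by (simp add: vec_def)

lemma vec_coords:
  assumes "x \<in> carrier G \<rightarrow>\<^sub>E UNIV"
  shows "vec G (coords G x) = x"
proof
  fix g
  show "vec G (coords G x) g = x g"
  proof (cases "g \<in> carrier G")
    case True
    then show ?thesis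
      using sum_representation_eq[OF independent_Basis _ finite_Basis order_refl, of "x g"] span_Basis
      by (simp add: vec_def coords_def)
  next
    case False
    then show ?thesis using PiE_arb[OF assms False] by (simp add: vec_def)
  qed
qed

lemma vec_cong:
  "(\<And>q. q \<in> carrier G \<times> Basis \<Longrightarrow> f q = f' q) \<Longrightarrow> vec G f = vec G f'"
  unfolding vec_def by (intro restrict_ext sum.cong) auto

lemma vec_inject:
  assumes "vec G f = vec G f'" "q \<in> carrier G \<times> Basis"
  shows "f q = f' q"
proof -
  obtain g l where q: "q = (g, l)" "g \<in> carrier G" "l \<in> Basis" using assms(2) by auto
  have "vec G f g = vec G f' g" using assms(1) by simp
  then have "(\<Sum>l\<in>Basis. scale (f (g, l) - f' (g, l)) l) = 0"
    using q(2) by (simp add: vec_def scale_left_diff_distrib sum_subtractf)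
  then have "f (g, l) - f' (g, l) = 0"
    using independentD[OF independent_Basis finite_Basis order_refl, of "\<lambda>l. f (g, l) - f' (g, l)"] q(3)
    by blast
  then show ?thesis using q(1) by simp
qed

lemma finsupp_coords:
  assumes "finite {g \<in> carrier G. x g \<noteq> 0}"
  shows "finsupp (carrier G \<times> Basis) (coords G x)"
proof -
  have "{q. coords G x q \<noteq> 0} \<subseteq> {g \<in> carrier G. x g \<noteq> 0} \<times> Basis"
    by (auto simp: coords_def representation_zero split: if_splits)
  moreover have "finite ({g \<in> carrier G. x g \<noteq> 0} \<times> Basis)" using assms finite_Basis by simp
  ultimately show ?thesis unfolding finsupp_def by (auto intro: finite_subset)
qed

lemma lin_maps_sum:
  assumes t: "t \<in> lin_maps scale M" and P: "finite P"
  shows "t (\<lambda>h\<in>M. \<Sum>p\<in>P. scale (c p) (w p h)) = (\<Sum>p\<in>P. scale (c p) (t (\<lambda>h\<in>M. w p h)))"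
proof -
  have add: "t (\<lambda>h\<in>M. x h + y h) = t x + t y" if "x \<in> M \<rightarrow>\<^sub>E UNIV" "y \<in> M \<rightarrow>\<^sub>E UNIV" for x y
    using t that by (simp add: lin_maps_def)
  have scl: "t (\<lambda>h\<in>M. scale a (x h)) = scale a (t x)" if "x \<in> M \<rightarrow>\<^sub>E UNIV" for a x
    using t that by (simp add: lin_maps_def)
  show ?thesis
    using P
  proof (induction P rule: finite_induct)
    case empty
    have "(\<lambda>h\<in>M. \<Sum>p\<in>{}. scale (c p) (w p h)) = (\<lambda>h\<in>M. scale 0 ((\<lambda>h\<in>M. 0) h))"
      by (intro restrict_ext) simp
    then have "t (\<lambda>h\<in>M. \<Sum>p\<in>{}. scale (c p) (w p h)) = t (\<lambda>h\<in>M. scale 0 ((\<lambda>h\<in>M. 0) h))"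
      by (rule arg_cong)
    also have "\<dots> = scale 0 (t (\<lambda>h\<in>M. 0))" by (rule scl) auto
    finally show ?case by (simp only: scale_zero_left sum.empty)
  next
    case (insert p P)
    let ?x = "\<lambda>h\<in>M. scale (c p) ((\<lambda>h\<in>M. w p h) h)" and ?y = "\<lambda>h\<in>M. \<Sum>p\<in>P. scale (c p) (w p h)"
    have "(\<lambda>h\<in>M. \<Sum>p\<in>insert p P. scale (c p) (w p h)) = (\<lambda>h\<in>M. ?x h + ?y h)"
      using insert.hyps by (intro restrict_ext) simp
    then have "t (\<lambda>h\<in>M. \<Sum>p\<in>insert p P. scale (c p) (w p h)) = t (\<lambda>h\<in>M. ?x h + ?y h)"
      by (rule arg_cong)
    also have "\<dots> = t ?x + t ?y" by (rule add) auto
    also have "t ?x = scale (c p) (t (\<lambda>h\<in>M. w p h))" by (rule scl) auto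
    also have "t ?y = (\<Sum>p\<in>P. scale (c p) (t (\<lambda>h\<in>M. w p h)))" by (rule insert.IH)
    finally show ?case by (simp only: sum.insert[OF insert.hyps])
  qed
qed

text \<open>The pattern seen from \<open>g\<close> is a combination of patterns with one basis
  vector at one site. Linearity of the local rule distributes over it, and \<open>symbol\<close>
  records the values on those patterns.\<close>

lemma nuca_vec:
  assumes G: "group G" and M: "finite M" "M \<subseteq> carrier G"
    and s: "s \<in> carrier G \<rightarrow> lin_maps scale M"
  shows "nuca G M s (vec G f) = vec G (mat_app (nuca_mat G M Basis (symbol M s)) f)"
proof
  interpret group G by fact
  let ?A = "mat_app (nuca_mat G M Basis (symbol M s)) f"
  fix g
  show "nuca G M s (vec G f) g = vec G ?A g"
  proof (cases "g \<in> carrier G")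
    case g: True
    let ?e = "\<lambda>q h. if h = fst q then snd q else 0"
    let ?f = "\<lambda>q. f (g \<otimes>\<^bsub>G\<^esub> fst q, snd q)"
    have finMB: "finite (M \<times> Basis)" using M(1) finite_Basis by simp
    have expand: "vec G f (g \<otimes>\<^bsub>G\<^esub> h) = (\<Sum>q\<in>M \<times> Basis. scale (?f q) (?e q h))" if h: "h \<in> M" for h
    proof -
      have "(\<Sum>q\<in>M \<times> Basis. scale (?f q) (?e q h))
          = (\<Sum>m\<in>M. \<Sum>l\<in>Basis. scale (f (g \<otimes>\<^bsub>G\<^esub> m, l)) (if h = m then l else 0))"
        by (simp add: sum.cartesian_product case_prod_unfold)
      also have "\<dots> = (\<Sum>m\<in>M. if h = m then \<Sum>l\<in>Basis. scale (f (g \<otimes>\<^bsub>G\<^esub> m, l)) l else 0)"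
        by (intro sum.cong) auto
      also have "\<dots> = vec G f (g \<otimes>\<^bsub>G\<^esub> h)"
        using M h g by (simp add: vec_def subset_iff)
      finally show ?thesis by simp
    qed
    have "nuca G M s (vec G f) g = s g (\<lambda>h\<in>M. \<Sum>q\<in>M \<times> Basis. scale (?f q) (?e q h))"
      using g expand by (simp add: nuca_def cong: restrict_cong)
    also have "\<dots> = (\<Sum>q\<in>M \<times> Basis. scale (?f q) (s g (\<lambda>h\<in>M. ?e q h)))"
      by (rule lin_maps_sum[OF funcset_mem[OF s g] finMB])
    also have "\<dots> = (\<Sum>q\<in>M \<times> Basis. scale (?f q) (\<Sum>i\<in>Basis. scale (symbol M s g (fst q) i (snd q)) i))"
      using sum_representation_eq[OF independent_Basis _ finite_Basis order_refl] span_Basis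
      by (simp add: symbol_def)
    also have "\<dots> = (\<Sum>q\<in>M \<times> Basis. \<Sum>i\<in>Basis. scale (symbol M s g (fst q) i (snd q) * ?f q) i)"
      by (simp add: scale_sum_right mult.commute)
    also have "\<dots> = (\<Sum>i\<in>Basis. \<Sum>q\<in>M \<times> Basis. scale (symbol M s g (fst q) i (snd q) * ?f q) i)"
      by (rule sum.swap)
    also have "\<dots> = (\<Sum>i\<in>Basis. scale (?A (g, i)) i)"
      using g by (intro sum.cong refl)
        (simp add: mat_app_nuca_mat[OF M finite_Basis] scale_sum_left case_prod_unfold)
    finally show ?thesis using g by (simp add: vec_def)
  qed (simp add: nuca_def vec_def)
qed

lemma mat_app_injective_of_nuca:
  assumes G: "group G" and M: "finite M" "M \<subseteq> carrier G"
    and s: "s \<in> carrier G \<rightarrow> lin_maps scale M"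
    and inj: "inj_on (nuca G M s) (carrier G \<rightarrow>\<^sub>E UNIV)"
    and x: "\<And>p. mat_app (nuca_mat G M Basis (symbol M s)) x p = 0" and q: "q \<in> carrier G \<times> Basis"
  shows "x q = 0"
proof -
  have "nuca G M s (vec G x) = nuca G M s (vec G (\<lambda>_. 0))"
    unfolding nuca_vec[OF G M s] by (rule vec_cong) (simp add: x, simp add: mat_app_def)
  then have "vec G x = vec G (\<lambda>_. 0)"
    using inj_onD[OF inj _ vec_in_PiE vec_in_PiE] by blast
  then show ?thesis using vec_inject q by fastforce
qed

text \<open>Post-surjectivity is applied at the zero configuration, which is its own image. A unit
  vector is asymptotic to it, and a preimage asymptotic to zero is finitely supported.\<close>

lemma mat_app_surjective_of_nuca:
  assumes G: "group G" and M: "finite M" "M \<subseteq> carrier G"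
    and s: "s \<in> carrier G \<rightarrow> lin_maps scale M"
    and post: "post_surjective G UNIV M s" and q: "q \<in> carrier G \<times> Basis"
  shows "\<exists>f. finsupp (carrier G \<times> Basis) f \<and>
    (\<forall>p. mat_app (nuca_mat G M Basis (symbol M s)) f p = (if p = q then 1 else 0))"
proof -
  let ?K = "nuca_mat G M Basis (symbol M s)" and ?\<delta> = "\<lambda>p. if p = q then 1 else 0"
  let ?zero = "vec G (\<lambda>_. 0)"
  have z0: "?zero g = 0" if "g \<in> carrier G" for g using that by (simp add: vec_def)
  have nuca0: "nuca G M s ?zero = ?zero"
    unfolding nuca_vec[OF G M s] by (rule vec_cong) (simp add: mat_app_def)
  have "{g \<in> carrier G. vec G ?\<delta> g \<noteq> ?zero g} \<subseteq> {fst q}"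
    by (auto simp: vec_def intro!: sum.neutral)
  then have asy: "asymptotic G (vec G ?\<delta>) (nuca G M s ?zero)"
    unfolding nuca0 asymptotic_def by (rule finite_subset) simp
  from post[unfolded post_surjective_def, rule_format, OF vec_in_PiE vec_in_PiE asy]
  obtain z where z: "z \<in> carrier G \<rightarrow>\<^sub>E UNIV" "asymptotic G z ?zero" "nuca G M s z = vec G ?\<delta>"
    by (elim bexE conjE)
  have "{g \<in> carrier G. z g \<noteq> 0} = {g \<in> carrier G. z g \<noteq> ?zero g}" using z0 by auto
  then have "finsupp (carrier G \<times> Basis) (coords G z)"
    using z(2) by (intro finsupp_coords) (simp add: asymptotic_def)
  moreover have "mat_app ?K (coords G z) p = ?\<delta> p" for p
  proof (cases "p \<in> carrier G \<times> Basis")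
    case True
    have "vec G (mat_app ?K (coords G z)) = vec G ?\<delta>"
      using nuca_vec[OF G M s, of "coords G z"] z by (simp add: vec_coords)
    then show ?thesis using True by (rule vec_inject)
  next
    case False
    then show ?thesis using q by (auto simp: mat_app_nuca_mat_outside)
  qed
  ultimately show ?thesis by blast
qed

lemma nuca_surjective_of_mat_app:
  assumes G: "group G" and M: "finite M" "M \<subseteq> carrier G"
    and s: "s \<in> carrier G \<rightarrow> lin_maps scale M"
    and surj: "\<And>t. \<exists>x. \<forall>p\<in>carrier G \<times> Basis. mat_app (nuca_mat G M Basis (symbol M s)) x p = t p"
  shows "nuca G M s ` (carrier G \<rightarrow>\<^sub>E UNIV) = carrier G \<rightarrow>\<^sub>E UNIV"
proof (intro equalityI subsetI)
  fix y :: "_ \<Rightarrow> 'b" assume y: "y \<in> carrier G \<rightarrow>\<^sub>E UNIV"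
  obtain x where "\<forall>p\<in>carrier G \<times> Basis.
      mat_app (nuca_mat G M Basis (symbol M s)) x p = coords G y p"
    using surj by blast
  then have "nuca G M s (vec G x) = vec G (coords G y)"
    unfolding nuca_vec[OF G M s] by (intro vec_cong) blast
  then show "y \<in> nuca G M s ` (carrier G \<rightarrow>\<^sub>E UNIV)"
    using vec_coords[OF y] vec_in_PiE by (metis imageI)
qed (auto simp: nuca_def)

text \<open>The coordinate difference of two asymptotic configurations with equal image is a
  finitely supported kernel vector.\<close>

lemma pre_injective_of_mat_app:
  assumes G: "group G" and M: "finite M" "M \<subseteq> carrier G"
    and s: "s \<in> carrier G \<rightarrow> lin_maps scale M"
    and inj: "\<And>z. finsupp (carrier G \<times> Basis) z \<Longrightarrow>
      (\<And>p. mat_app (nuca_mat G M Basis (symbol M s)) z p = 0) \<Longrightarrow> z = (\<lambda>_. 0)"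
  shows "pre_injective G UNIV M s"
  unfolding pre_injective_def
proof (intro ballI impI)
  interpret group G by fact
  let ?K = "nuca_mat G M Basis (symbol M s)"
  fix x y :: "_ \<Rightarrow> 'b"
  assume xy: "x \<in> carrier G \<rightarrow>\<^sub>E UNIV" "y \<in> carrier G \<rightarrow>\<^sub>E UNIV" "asymptotic G x y"
    "nuca G M s x = nuca G M s y"
  define z where "z = (\<lambda>q. coords G x q - coords G y q)"
  have "finsupp (carrier G \<times> Basis) z"
  proof -
    have "{q. z q \<noteq> 0} \<subseteq> {g \<in> carrier G. x g \<noteq> y g} \<times> Basis"
      by (auto simp: z_def coords_def split: if_splits)
    moreover have "finite ({g \<in> carrier G. x g \<noteq> y g} \<times> Basis)"
      using xy(3) finite_Basis by (simp add: asymptotic_def)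
    ultimately show ?thesis unfolding finsupp_def by (auto intro: finite_subset)
  qed
  moreover have "mat_app ?K z p = 0" for p
  proof (cases "p \<in> carrier G \<times> Basis")
    case False
    then show ?thesis by (rule mat_app_nuca_mat_outside)
  next
    case True
    then obtain g i where p: "p = (g, i)" "g \<in> carrier G" "i \<in> Basis" by auto
    have "vec G (mat_app ?K (coords G x)) = vec G (mat_app ?K (coords G y))"
      using xy(4) nuca_vec[OF G M s, of "coords G x"] nuca_vec[OF G M s, of "coords G y"] xy(1,2)
      by (simp add: vec_coords)
    then have "mat_app ?K (coords G x) p = mat_app ?K (coords G y) p" using True by (rule vec_inject)
    then show ?thesis
      unfolding p(1) mat_app_nuca_mat[OF M finite_Basis p(2,3)]
      by (simp add: z_def case_prod_unfold right_diff_distrib sum_subtractf)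
  qed
  ultimately have "z = (\<lambda>_. 0)" by (rule inj)
  then have "coords G x = coords G y" by (auto simp: z_def fun_eq_iff)
  then show "x = y" using vec_coords xy(1,2) by metis
qed

end

section \<open>Orbit closures and the two surjunctivity properties\<close>

lemma (in group) self_in_orbit_closure:
  assumes "s \<in> carrier G \<rightarrow>\<^sub>E S"
  shows "s \<in> orbit_closure G S s"
proof -
  have "translate G g s \<in> carrier G \<rightarrow>\<^sub>E S" if "g \<in> carrier G" for g
    using assms that by (auto simp: translate_def)
  then have "(\<lambda>g. translate G g s) ` carrier G
      \<subseteq> topspace (product_topology (\<lambda>_. discrete_topology S) (carrier G))"
    by (auto simp: topspace_product_topology)
  then have "(\<lambda>g. translate G g s) ` carrier G \<subseteq> orbit_closure G S s"
    unfolding orbit_closure_def by (rule closure_of_subset)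
  moreover have "translate G \<one> s = s"
  proof
    show "translate G \<one> s h = s h" for h
      using PiE_arb[OF assms, of h] by (cases "h \<in> carrier G") (simp_all add: translate_def)
  qed
  ultimately show ?thesis using one_closed by (metis image_subset_iff)
qed

text \<open>A basic neighbourhood constrains finitely many coordinates, and in an infinite group
  some translation moves \<open>F\<close> off all of them.\<close>

lemma (in group) const_in_orbit_closure:
  assumes inf: "infinite (carrier G)" and F: "finite F"
    and s: "s \<in> carrier G \<rightarrow>\<^sub>E S" "\<And>g. g \<in> carrier G - F \<Longrightarrow> s g = c"
  shows "(\<lambda>g\<in>carrier G. c) \<in> orbit_closure G S s"
  unfolding orbit_closure_def in_closure_of
proof (intro conjI allI impI)
  obtain g0 where "g0 \<in> carrier G" "g0 \<notin> F"
    using inf F by (meson finite_subset subsetI)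
  then have c: "c \<in> S" using s by (metis DiffI PiE_mem)
  show "(\<lambda>g\<in>carrier G. c) \<in> topspace (product_topology (\<lambda>_. discrete_topology S) (carrier G))"
    using c by (auto simp: topspace_product_topology)
  fix T assume T: "(\<lambda>g\<in>carrier G. c) \<in> T \<and> openin (product_topology (\<lambda>_. discrete_topology S) (carrier G)) T"
  then obtain U where U: "finite {h \<in> carrier G. U h \<noteq> topspace (discrete_topology S)}"
      "(\<lambda>g\<in>carrier G. c) \<in> Pi\<^sub>E (carrier G) U" "Pi\<^sub>E (carrier G) U \<subseteq> T"
    unfolding openin_product_topology_alt by blast
  let ?D = "{h \<in> carrier G. U h \<noteq> S}"
  \<comment> \<open>If \<open>inv g \<otimes> h\<close> were an element \<open>f\<close> of
    \<open>F\<close>, then \<open>g = h \<otimes> inv f\<close>; a \<open>g\<close> avoiding these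
    elements shows the value \<open>c\<close> on all of \<open>?D\<close>.\<close>
  have "finite ((\<lambda>(h, f). h \<otimes> inv f) ` (?D \<times> F))" using U(1) F by simp
  then obtain g where g: "g \<in> carrier G" "g \<notin> (\<lambda>(h, f). h \<otimes> inv f) ` (?D \<times> F)"
    using inf by (meson finite_subset subsetI)
  have "s (inv g \<otimes> h) \<in> U h" if h: "h \<in> carrier G" for h
  proof (cases "U h = S")
    case True
    then show ?thesis using PiE_mem[OF s(1), of "inv g \<otimes> h"] g(1) h by simp
  next
    case False
    have "h \<otimes> inv (inv g \<otimes> h) = g" using g(1) h by (simp add: inv_mult_group m_assoc[symmetric])
    then have "inv g \<otimes> h \<notin> F" using g(2) h False by force
    then have "s (inv g \<otimes> h) = c" using g(1) h by (intro s(2)) simp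
    then show ?thesis using U(2) h by (auto dest: PiE_mem)
  qed
  then have "translate G g s \<in> Pi\<^sub>E (carrier G) U" by (auto simp: translate_def)
  then show "\<exists>y. y \<in> (\<lambda>g. translate G g s) ` carrier G \<and> y \<in> T" using U(3) g(1) by blast
qed

lemma L1_surjunctive_if_initially_subamenable:
  fixes G :: "('g, 'c) monoid_scheme"
  assumes G: "group G" "initially_subamenable TYPE('h) G"
  shows "L1_surjunctive TYPE('k::field) TYPE('v::ab_group_add) G"
  unfolding L1_surjunctive_def
proof (intro allI impI)
  interpret group G by fact
  fix smult_v :: "'k \<Rightarrow> 'v \<Rightarrow> 'v" and Basis M s
  assume "finite_dimensional_vector_space smult_v Basis" and L: "LNUCA_c_param G smult_v M s"
    and stab: "stably_injective G UNIV M (lin_maps smult_v M) s"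
  then interpret finite_dimensional_vector_space smult_v Basis by simp
  obtain F c where M: "finite M" "M \<subseteq> carrier G" and s: "s \<in> carrier G \<rightarrow>\<^sub>E lin_maps smult_v M"
    and F: "finite F" "F \<subseteq> carrier G" "\<And>g. g \<in> carrier G - F \<Longrightarrow> s g = c"
    using L unfolding LNUCA_c_param_def by blast
  have s': "s \<in> carrier G \<rightarrow> lin_maps smult_v M" using s by auto
  \<comment> \<open>The configuration \<open>?c\<close> equals \<open>c\<close> on
    \<open>carrier G\<close> only, so the symbol is taken from the total constant function, where
    the base point \<open>\<one>\<close> is an arbitrary choice.\<close>
  let ?c = "\<lambda>g\<in>carrier G. c" and ?\<gamma> = "symbol M (\<lambda>_. c) \<one>\<^bsub>G\<^esub>"
  have const: "nuca_mat G M Basis (symbol M ?c) = nuca_mat G M Basis (\<lambda>_. ?\<gamma>)"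
    by (rule nuca_mat_cong) (simp add: symbol_def fun_eq_iff)
  show "nuca G M s ` (carrier G \<rightarrow>\<^sub>E UNIV) = carrier G \<rightarrow>\<^sub>E UNIV"
  proof (rule nuca_surjective_of_mat_app[OF G(1) M s'],
      rule nuca_mat_injective_imp_surjective[OF G M finite_Basis F(1,2)])
    show "symbol M s g = ?\<gamma>" if "g \<in> carrier G - F" for g
      using F(3)[OF that] by (simp add: symbol_def fun_eq_iff)
    have "inj_on (nuca G M s) (carrier G \<rightarrow>\<^sub>E UNIV)"
      using stab self_in_orbit_closure[OF s] by (simp add: stably_injective_def)
    then show "x q = 0" if "\<And>p. mat_app (nuca_mat G M Basis (symbol M s)) x p = 0" "q \<in> carrier G \<times> Basis"
      for x q by (rule mat_app_injective_of_nuca[OF G(1) M s' _ that])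
    show "x q = 0" if inf: "infinite (carrier G)"
      and x: "\<And>p. mat_app (nuca_mat G M Basis (\<lambda>_. ?\<gamma>)) x p = 0" and q: "q \<in> carrier G \<times> Basis" for x q
    proof -
      have cl: "?c \<in> orbit_closure G (lin_maps smult_v M) s"
        by (rule const_in_orbit_closure[OF inf F(1) s F(3)])
      \<comment> \<open>That \<open>c\<close> is a linear local rule follows from its being the
        value of \<open>s\<close> at a cell outside \<open>F\<close>, which the infinite group
        provides.\<close>
      obtain g where "g \<in> carrier G - F" using inf F(1) by (metis Diff_eq_empty_iff all_not_in_conv finite_subset)
      then have "c \<in> lin_maps smult_v M" using s' F(3) by (metis DiffD1 funcset_mem)
      then have c: "?c \<in> carrier G \<rightarrow> lin_maps smult_v M" by simp
      have "inj_on (nuca G M ?c) (carrier G \<rightarrow>\<^sub>E UNIV)"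
        using stab cl by (simp add: stably_injective_def)
      then show ?thesis by (rule mat_app_injective_of_nuca[OF G(1) M c _ x[folded const] q])
    qed
  qed
qed

text \<open>Here the matrix itself, rather than its transpose, acts on finitely supported vectors,
  and pre-injectivity is the triviality of its kernel there.\<close>

lemma dual_L1_surjunctive_if_initially_subamenable:
  fixes G :: "('g, 'c) monoid_scheme"
  assumes G: "group G" "initially_subamenable TYPE('h) G"
  shows "dual_L1_surjunctive TYPE('k::field) TYPE('v::ab_group_add) G"
  unfolding dual_L1_surjunctive_def
proof (intro allI impI)
  interpret group G by fact
  fix smult_v :: "'k \<Rightarrow> 'v \<Rightarrow> 'v" and Basis M s
  assume "finite_dimensional_vector_space smult_v Basis" and L: "LNUCA_c_param G smult_v M s"
    and stab: "stably_post_surjective G UNIV M (lin_maps smult_v M) s"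
  then interpret finite_dimensional_vector_space smult_v Basis by simp
  obtain F c where M: "finite M" "M \<subseteq> carrier G" and s: "s \<in> carrier G \<rightarrow>\<^sub>E lin_maps smult_v M"
    and F: "finite F" "F \<subseteq> carrier G" "\<And>g. g \<in> carrier G - F \<Longrightarrow> s g = c"
    using L unfolding LNUCA_c_param_def by blast
  have s': "s \<in> carrier G \<rightarrow> lin_maps smult_v M" using s by auto
  let ?c = "\<lambda>g\<in>carrier G. c" and ?\<gamma> = "symbol M (\<lambda>_. c) \<one>\<^bsub>G\<^esub>"
  have const: "nuca_mat G M Basis (symbol M ?c) = nuca_mat G M Basis (\<lambda>_. ?\<gamma>)"
    by (rule nuca_mat_cong) (simp add: symbol_def fun_eq_iff)
  show "pre_injective G UNIV M s"
  proof (rule pre_injective_of_mat_app[OF G(1) M s'],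
      rule nuca_mat_surjective_imp_injective[OF G M finite_Basis F(1,2)])
    show "symbol M s g = ?\<gamma>" if "g \<in> carrier G - F" for g
      using F(3)[OF that] by (simp add: symbol_def fun_eq_iff)
    have "post_surjective G UNIV M s"
      using stab self_in_orbit_closure[OF s] by (simp add: stably_post_surjective_def)
    then show "\<exists>f. finsupp (carrier G \<times> Basis) f \<and>
        (\<forall>p. mat_app (nuca_mat G M Basis (symbol M s)) f p = (if p = q then 1 else 0))"
      if "q \<in> carrier G \<times> Basis" for q by (rule mat_app_surjective_of_nuca[OF G(1) M s' _ that])
    show "\<exists>f. finsupp (carrier G \<times> Basis) f \<and>
        (\<forall>p. mat_app (nuca_mat G M Basis (\<lambda>_. ?\<gamma>)) f p = (if p = q then 1 else 0))"
      if inf: "infinite (carrier G)" and q: "q \<in> carrier G \<times> Basis" for q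
    proof -
      have cl: "?c \<in> orbit_closure G (lin_maps smult_v M) s"
        by (rule const_in_orbit_closure[OF inf F(1) s F(3)])
      obtain g where "g \<in> carrier G - F" using inf F(1) by (metis Diff_eq_empty_iff all_not_in_conv finite_subset)
      then have "c \<in> lin_maps smult_v M" using s' F(3) by (metis DiffD1 funcset_mem)
      then have c: "?c \<in> carrier G \<rightarrow> lin_maps smult_v M" by simp
      have "post_surjective G UNIV M ?c"
        using stab cl by (simp add: stably_post_surjective_def)
      then show ?thesis unfolding const[symmetric] by (rule mat_app_surjective_of_nuca[OF G(1) M c _ q])
    qed
  qed
qed

theorem theoremC:
  fixes G :: "'g monoid"
  assumes "group G"
    and "initially_subamenable TYPE('h) G \<or> residually_finite TYPE('f) G"
  shows "L1_surjunctive TYPE('k::field) TYPE('v::ab_group_add) G \<and>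
         dual_L1_surjunctive TYPE('k) TYPE('v) G"
  using assms(2)
proof
  assume "initially_subamenable TYPE('h) G"
  then show ?thesis
    using assms(1) L1_surjunctive_if_initially_subamenable dual_L1_surjunctive_if_initially_subamenable
    by blast
next
  assume "residually_finite TYPE('f) G"
  then have "initially_subamenable TYPE('f) G" by (rule residually_finite_imp_initially_subamenable)
  then show ?thesis
    using assms(1) L1_surjunctive_if_initially_subamenable dual_L1_surjunctive_if_initially_subamenable
    by blast
qed

end
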